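(* Let $I_x$ be a set of representatives of the left cosets of $G_{xy}$ in $G_x$ and $I_y$ a set of representatives of the left cosets of $G_{xy}$ in $G_y$. Then the subgroup of $G$ generated by $I_x\cup I_y$ acts transitively on the orbit $\mathcal O$: for every $(u,v)\in\mathcal O$ there exists $\sigma$ in this subgroup with $\sigma\cdot(x,y)=(u,v)$.
   Context: Fix a finite set $\mathcal S\subset\mathbb Z^2$ and nonzero complex weights $(w_s)_{s\in\mathcal S}$; the step polynomial is $S(X,Y)=\sum_{(i,j)\in\mathcal S}w_{(i,j)}X^iY^j$, assumed not univariate. Let $x,y$ be algebraically independent over $\mathbb C$, $k=\mathbb C(S(x,y))$, and $\mathbb K$ a fixed algebraic closure of $\mathbb C(x,y)$. Write $(u,v)\sim^x(u',v')$ if $u=u'$ and $S(u,v)=S(u',v')$, and $(u,v)\sim^y(u',v')$ if $v=v'$ and $S(u,v)=S(u',v')$ (for pairs in $\mathbb K\times\mathbb K$). The orbit $\mathcal O$ is the equivalence class of $(x,y)$ for the equivalence relation generated by $\sim^x$ and $\sim^y$. Let $k(\mathcal O)\subset\mathbb K$ be the field generated over $k$ by all coordinates of pairs in $\mathcal O$. Set $G_x=\mathrm{Aut}(k(\mathcal O)|k(x))$, $G_y=\mathrm{Aut}(k(\mathcal O)|k(y))$, $G_{xy}=\mathrm{Aut}(k(\mathcal O)|k(x,y))$ (field automorphisms fixing the indicated subfield pointwise), and let $G$ (the group of the walk) be the subgroup of $\mathrm{Aut}(k(\mathcal O)|k)$ generated by $G_x\cup G_y$. An automorphism $\sigma$ acts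 on pairs by $\sigma\cdot(u,v)=(\sigma(u),\sigma(v))$; elements of $G$ map $\mathcal O$ into itself. *)

theory Defs
  imports
    Complex_Main
    "HOL-Computational_Algebra.Polynomial"
    "HOL-Algebra.Algebraic_Closure_Type"
    "HOL-Algebra.Generated_Fields"
    "HOL-Algebra.Generated_Groups"
    "HOL-Algebra.Left_Coset"
    "HOL-Algebra.Group_Action"
begin

text \<open>
  The ambient field \<open>\<bbbK>\<close> is an arbitrary type \<open>'k\<close> of class \<open>field\<close>; the complex numbers are
  embedded in it by a ring homomorphism \<open>c :: complex \<Rightarrow> 'k\<close>.
\<close>

subsection \<open>Subfields and automorphisms\<close>

definition field_gen :: "'k::field set \<Rightarrow> 'k set" where
  "field_gen A = generate_field (ring_of_type_algebra :: 'k ring) A"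

definition subfield_ring :: "'k::field set \<Rightarrow> 'k ring" where
  "subfield_ring L = (ring_of_type_algebra :: 'k ring)\<lparr>carrier := L\<rparr>"

text \<open>As in \<open>BijGroup\<close>, automorphisms of \<open>L\<close> are extensional functions on \<open>L\<close>.\<close>

definition field_Aut :: "'k::field set \<Rightarrow> 'k set \<Rightarrow> ('k \<Rightarrow> 'k) set" where
  "field_Aut L F =
     {\<sigma> \<in> Bij L. \<sigma> \<in> ring_hom (subfield_ring L) (subfield_ring L) \<and> (\<forall>a\<in>F. \<sigma> a = a)}"

definition Aut_group :: "'k::field set \<Rightarrow> 'k set \<Rightarrow> ('k \<Rightarrow> 'k) monoid" where
  "Aut_group L F = (BijGroup L)\<lparr>carrier := field_Aut L F\<rparr>"

definition left_coset_reps :: "('g, 'h) monoid_scheme \<Rightarrow> 'g set \<Rightarrow> 'g set \<Rightarrow> bool" where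
  "left_coset_reps G H I \<longleftrightarrow> I \<subseteq> carrier G \<and> (\<forall>C \<in> lcosets\<^bsub>G\<^esub> H. \<exists>!g. g \<in> I \<and> g \<in> C)"

definition alg_indep2 :: "(complex \<Rightarrow> 'k::field) \<Rightarrow> 'k \<Rightarrow> 'k \<Rightarrow> bool" where
  "alg_indep2 c x y \<longleftrightarrow>
     (\<forall>P :: complex poly poly. poly (map_poly (\<lambda>q. poly (map_poly c q) x) P) y = 0 \<longrightarrow> P = 0)"

subsection \<open>The step polynomial and the orbit\<close>

definition not_univariate :: "(int \<times> int) set \<Rightarrow> bool" where
  "not_univariate \<S> \<longleftrightarrow> (\<exists>(i, j)\<in>\<S>. i \<noteq> 0) \<and> (\<exists>(i, j)\<in>\<S>. j \<noteq> 0)"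

definition step_poly ::
  "(complex \<Rightarrow> 'k::field) \<Rightarrow> (int \<times> int) set \<Rightarrow> (int \<times> int \<Rightarrow> complex) \<Rightarrow> 'k \<times> 'k \<Rightarrow> 'k" where
  "step_poly c \<S> w = (\<lambda>(u, v). \<Sum>(i, j)\<in>\<S>. c (w (i, j)) * (u powi i) * (v powi j))"

text \<open>
  The Laurent polynomial \<open>S\<close> has no value at \<open>(u, v)\<close> if a coordinate with a negative exponent
  vanishes, whereas \<open>0 powi i = 0\<close> for \<open>i < 0\<close>. The relations below only relate pairs at which
  \<open>S\<close> has a value.
\<close>

definition step_defined :: "(int \<times> int) set \<Rightarrow> 'k::field \<times> 'k \<Rightarrow> bool" where
  "step_defined \<S> = (\<lambda>(u, v). \<forall>(i, j)\<in>\<S>. (i < 0 \<longrightarrow> u \<noteq> 0) \<and> (j < 0 \<longrightarrow> v \<noteq> 0))"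

definition same_step_value ::
  "(complex \<Rightarrow> 'k::field) \<Rightarrow> (int \<times> int) set \<Rightarrow> (int \<times> int \<Rightarrow> complex) \<Rightarrow> 'k \<times> 'k \<Rightarrow> 'k \<times> 'k \<Rightarrow> bool" where
  "same_step_value c \<S> w p q \<longleftrightarrow>
     step_defined \<S> p \<and> step_defined \<S> q \<and> step_poly c \<S> w p = step_poly c \<S> w q"

definition sim_x ::
  "(complex \<Rightarrow> 'k::field) \<Rightarrow> (int \<times> int) set \<Rightarrow> (int \<times> int \<Rightarrow> complex) \<Rightarrow> 'k \<times> 'k \<Rightarrow> 'k \<times> 'k \<Rightarrow> bool" where
  "sim_x c \<S> w p q \<longleftrightarrow> fst p = fst q \<and> same_step_value c \<S> w p q"

definition sim_y ::
  "(complex \<Rightarrow> 'k::field) \<Rightarrow> (int \<times> int) set \<Rightarrow> (int \<times> int \<Rightarrow> complex) \<Rightarrow> 'k \<times> 'k \<Rightarrow> 'k \<times> 'k \<Rightarrow> bool" where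
  "sim_y c \<S> w p q \<longleftrightarrow> snd p = snd q \<and> same_step_value c \<S> w p q"

definition walk_orbit ::
  "(complex \<Rightarrow> 'k::field) \<Rightarrow> (int \<times> int) set \<Rightarrow> (int \<times> int \<Rightarrow> complex) \<Rightarrow> 'k \<Rightarrow> 'k \<Rightarrow> ('k \<times> 'k) set" where
  "walk_orbit c \<S> w x y =
     {p. equivclp (\<lambda>p q. sim_x c \<S> w p q \<or> sim_y c \<S> w p q) (x, y) p}"

definition base_field ::
  "(complex \<Rightarrow> 'k::field) \<Rightarrow> (int \<times> int) set \<Rightarrow> (int \<times> int \<Rightarrow> complex) \<Rightarrow> 'k \<Rightarrow> 'k \<Rightarrow> 'k set" where
  "base_field c \<S> w x y = field_gen (range c \<union> {step_poly c \<S> w (x, y)})"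

definition orbit_field ::
  "(complex \<Rightarrow> 'k::field) \<Rightarrow> (int \<times> int) set \<Rightarrow> (int \<times> int \<Rightarrow> complex) \<Rightarrow> 'k \<Rightarrow> 'k \<Rightarrow> 'k set" where
  "orbit_field c \<S> w x y =
     field_gen (base_field c \<S> w x y \<union> fst ` walk_orbit c \<S> w x y \<union> snd ` walk_orbit c \<S> w x y)"

subsection \<open>The group of the walk\<close>

definition walk_Gx ::
  "(complex \<Rightarrow> 'k::field) \<Rightarrow> (int \<times> int) set \<Rightarrow> (int \<times> int \<Rightarrow> complex) \<Rightarrow> 'k \<Rightarrow> 'k \<Rightarrow> ('k \<Rightarrow> 'k) monoid" where
  "walk_Gx c \<S> w x y =
     Aut_group (orbit_field c \<S> w x y) (field_gen (base_field c \<S> w x y \<union> {x}))"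

definition walk_Gy ::
  "(complex \<Rightarrow> 'k::field) \<Rightarrow> (int \<times> int) set \<Rightarrow> (int \<times> int \<Rightarrow> complex) \<Rightarrow> 'k \<Rightarrow> 'k \<Rightarrow> ('k \<Rightarrow> 'k) monoid" where
  "walk_Gy c \<S> w x y =
     Aut_group (orbit_field c \<S> w x y) (field_gen (base_field c \<S> w x y \<union> {y}))"

definition walk_Gxy ::
  "(complex \<Rightarrow> 'k::field) \<Rightarrow> (int \<times> int) set \<Rightarrow> (int \<times> int \<Rightarrow> complex) \<Rightarrow> 'k \<Rightarrow> 'k \<Rightarrow> ('k \<Rightarrow> 'k) monoid" where
  "walk_Gxy c \<S> w x y =
     Aut_group (orbit_field c \<S> w x y) (field_gen (base_field c \<S> w x y \<union> {x, y}))"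

definition walk_group ::
  "(complex \<Rightarrow> 'k::field) \<Rightarrow> (int \<times> int) set \<Rightarrow> (int \<times> int \<Rightarrow> complex) \<Rightarrow> 'k \<Rightarrow> 'k \<Rightarrow> ('k \<Rightarrow> 'k) monoid" where
  "walk_group c \<S> w x y =
     (let A = Aut_group (orbit_field c \<S> w x y) (base_field c \<S> w x y)
      in A\<lparr>carrier := generate A (carrier (walk_Gx c \<S> w x y) \<union> carrier (walk_Gy c \<S> w x y))\<rparr>)"

definition pair_act :: "('k \<Rightarrow> 'k) \<Rightarrow> 'k \<times> 'k \<Rightarrow> 'k \<times> 'k" where
  "pair_act \<sigma> = (\<lambda>(u, v). (\<sigma> u, \<sigma> v))"

end

theory Submission
  imports Defs
begin

text \<open>
  Both relations are equivariant under automorphisms, so it suffices to reach the neighbours of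
  \<open>(x, y)\<close>. If \<open>(x, v)\<close> is a neighbour, substituting \<open>v\<close> for \<open>y\<close> is a ring homomorphism defined on all
  rational functions in \<open>x, y\<close> whose denominator does not vanish at \<open>(x, v)\<close>. It fixes \<open>\<complex>\<close>, \<open>x\<close> and
  \<open>S(x, y) = S(x, v)\<close>, hence \<open>k(x)\<close>; so every polynomial over \<open>k(x)\<close> that vanishes at \<open>y\<close> vanishes at
  \<open>v\<close>, and no irreducibility argument is needed to see that \<open>y\<close> and \<open>v\<close> are conjugate over \<open>k(x)\<close>.
  By Zorn's lemma \<open>y \<mapsto> v\<close> extends to a maximal isomorphism between subfields of \<open>\<bbbK>\<close>, which is an
  automorphism of \<open>\<bbbK>\<close>. It permutes the orbit, so it restricts to an element of \<open>G\<^sub>x\<close>, and the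
  representative of its coset agrees with it on \<open>(x, y)\<close> because \<open>G\<^sub>x\<^sub>y\<close> fixes both coordinates.
\<close>

subsection \<open>Partial isomorphisms of a field\<close>

text \<open>
  Homomorphisms between subrings of a field are represented by their graphs, which makes domain and
  range interchangeable. A \<open>partial_hom\<close> may have a kernel; its domain is then a local ring, not
  a field.
\<close>

locale partial_hom =
  fixes R :: "('k::field \<times> 'k) set"
  assumes one: "(1, 1) \<in> R"
    and diff: "\<lbrakk>(a, b) \<in> R; (a', b') \<in> R\<rbrakk> \<Longrightarrow> (a - a', b - b') \<in> R"
    and mult: "\<lbrakk>(a, b) \<in> R; (a', b') \<in> R\<rbrakk> \<Longrightarrow> (a * a', b * b') \<in> R"
    and inverse_unit: "\<lbrakk>(a, b) \<in> R; b \<noteq> 0\<rbrakk> \<Longrightarrow> (inverse a, inverse b) \<in> R"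
    and zero_left: "(0, b) \<in> R \<Longrightarrow> b = 0"
begin

lemma zero: "(0, 0) \<in> R"
  using diff[OF one one] by simp

lemma uminus: "(a, b) \<in> R \<Longrightarrow> (- a, - b) \<in> R"
  using diff[OF zero, of a b] by simp

lemma add: "\<lbrakk>(a, b) \<in> R; (a', b') \<in> R\<rbrakk> \<Longrightarrow> (a + a', b + b') \<in> R"
  using diff[OF _ uminus, of a b a' b'] by simp

lemma sum: "(\<And>i. i \<in> I \<Longrightarrow> (f i, g i) \<in> R) \<Longrightarrow> (sum f I, sum g I) \<in> R"
  by (induction I rule: infinite_finite_induct) (auto intro: zero add)

lemma single_valued: "\<lbrakk>(a, b) \<in> R; (a, b') \<in> R\<rbrakk> \<Longrightarrow> b = b'"
  using zero_left[of "b - b'"] diff[of a b a b'] by simp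

lemma power: "(a, b) \<in> R \<Longrightarrow> (a ^ n, b ^ n) \<in> R"
  by (induction n) (auto intro: one mult)

text \<open>For a negative exponent it is the image \<open>b\<close> that has to be nonzero:
  \<open>inverse_unit\<close> then places the inverse of \<open>a\<close> in the domain.\<close>

lemma power_int: "\<lbrakk>(a, b) \<in> R; i < 0 \<longrightarrow> b \<noteq> 0\<rbrakk> \<Longrightarrow> (a powi i, b powi i) \<in> R"
  by (auto simp: power_int_def intro: power inverse_unit)

end

text \<open>With \<open>zero_right\<close> the axioms become symmetric in the two components:
  nonzero elements correspond to nonzero elements, so domain and range are isomorphic
  fields.\<close>

locale partial_iso = partial_hom R for R :: "('k::field \<times> 'k) set" +
  assumes zero_right: "(a, 0) \<in> R \<Longrightarrow> a = 0"
begin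

lemma eq_zero_iff: "(a, b) \<in> R \<Longrightarrow> a = 0 \<longleftrightarrow> b = 0"
  using zero_left zero_right by blast

lemma inv: "(a, b) \<in> R \<Longrightarrow> (inverse a, inverse b) \<in> R"
  using inverse_unit[of a b] zero zero_right[of a] by (cases "b = 0") auto

lemma injective: "\<lbrakk>(a, b) \<in> R; (a', b) \<in> R\<rbrakk> \<Longrightarrow> a = a'"
  using zero_right[of "a - a'"] diff[of a b a' b] by simp

end

lemma partial_isoI:
  assumes "(1, 1) \<in> R"
    and "\<And>a b a' b'. \<lbrakk>(a, b) \<in> R; (a', b') \<in> R\<rbrakk> \<Longrightarrow> (a - a', b - b') \<in> R"
    and "\<And>a b a' b'. \<lbrakk>(a, b) \<in> R; (a', b') \<in> R\<rbrakk> \<Longrightarrow> (a * a', b * b') \<in> R"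
    and "\<And>a b. (a, b) \<in> R \<Longrightarrow> (inverse a, inverse b) \<in> R"
    and "\<And>a b. (a, b) \<in> R \<Longrightarrow> a = 0 \<longleftrightarrow> b = 0"
  shows "partial_iso R"
  by unfold_locales (auto intro: assms(1-4) dest: assms(5))

lemma (in partial_iso) partial_iso_converse: "partial_iso (R\<inverse>)"
proof (rule partial_isoI)
  fix a b assume "(a, b) \<in> R\<inverse>"
  thus "a = 0 \<longleftrightarrow> b = 0"
    using eq_zero_iff[of b a] by simp
qed (auto intro: one diff mult inv)

section \<open>Polynomials with corresponding coefficients\<close>

definition poly_rel :: "('k::field \<times> 'k) set \<Rightarrow> ('k poly \<times> 'k poly) set" where
  "poly_rel R = {(p, q). \<forall>i. (coeff p i, coeff q i) \<in> R}"

context partial_iso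
begin

lemma poly_relD: "(p, q) \<in> poly_rel R \<Longrightarrow> (coeff p i, coeff q i) \<in> R"
  by (simp add: poly_rel_def)

lemma poly_rel_diff:
  "\<lbrakk>(p, q) \<in> poly_rel R; (p', q') \<in> poly_rel R\<rbrakk> \<Longrightarrow> (p - p', q - q') \<in> poly_rel R"
  by (simp add: poly_rel_def diff)

lemma poly_rel_add:
  "\<lbrakk>(p, q) \<in> poly_rel R; (p', q') \<in> poly_rel R\<rbrakk> \<Longrightarrow> (p + p', q + q') \<in> poly_rel R"
  by (simp add: poly_rel_def add)

lemma poly_rel_mult:
  "\<lbrakk>(p, q) \<in> poly_rel R; (p', q') \<in> poly_rel R\<rbrakk> \<Longrightarrow> (p * p', q * q') \<in> poly_rel R"
  by (simp add: poly_rel_def coeff_mult sum mult)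

lemma poly_rel_monom: "(a, b) \<in> R \<Longrightarrow> (monom a n, monom b n) \<in> poly_rel R"
  by (simp add: poly_rel_def zero)

lemma poly_rel_const: "(a, b) \<in> R \<Longrightarrow> ([:a:], [:b:]) \<in> poly_rel R"
  using poly_rel_monom[of a b 0] by (simp add: monom_0)

lemma poly_rel_zero: "(0, 0) \<in> poly_rel R"
  by (simp add: poly_rel_def zero)

lemma poly_rel_eq_zero_iff: "(p, q) \<in> poly_rel R \<Longrightarrow> p = 0 \<longleftrightarrow> q = 0"
  using eq_zero_iff[OF poly_relD] by (simp add: poly_eq_iff)

lemma poly_rel_degree: "(p, q) \<in> poly_rel R \<Longrightarrow> Polynomial.degree p = Polynomial.degree q"
  using eq_zero_iff[OF poly_relD] by (simp add: Polynomial.degree_def)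

text \<open>Long division uses nothing but field operations on coefficients, so it can be run on
  both components in parallel and produces corresponding quotients and remainders.\<close>

lemma poly_rel_division:
  assumes "(p, p') \<in> poly_rel R" "(g, g') \<in> poly_rel R" "g \<noteq> 0"
  shows "\<exists>q q' r r'. (q, q') \<in> poly_rel R \<and> (r, r') \<in> poly_rel R \<and> p = g * q + r \<and>
           p' = g' * q' + r' \<and> (r = 0 \<or> Polynomial.degree r < Polynomial.degree g)"
  using assms(1)
proof (induction "Polynomial.degree p" arbitrary: p p' rule: less_induct)
  case less
  show ?case
  proof (cases "p = 0 \<or> Polynomial.degree p < Polynomial.degree g")
    case True
    have "p = g * 0 + p" "p' = g' * 0 + p'"
      by simp_all
    with True less.prems poly_rel_zero show ?thesis
      by blast
  next
    case False
    \<comment> \<open>\<open>monom a n\<close> is the leading term of the quotient, chosen so that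
      \<open>g * h\<close> and \<open>p\<close> have the same leading term; \<open>a'\<close> is the
      same expression in the second component.\<close>
    define n where "n = Polynomial.degree p - Polynomial.degree g"
    define a where "a = lead_coeff p * inverse (lead_coeff g)"
    define a' where "a' = lead_coeff p' * inverse (lead_coeff g')"
    define h where "h = monom a n"
    define h' where "h' = monom a' n"
    have h: "(h, h') \<in> poly_rel R"
      unfolding h_def h'_def a_def a'_def
      using less.prems assms(2) poly_rel_degree[OF less.prems] poly_rel_degree[OF assms(2)]
      by (intro poly_rel_monom mult inv) (metis poly_relD)+
    define s where "s = p - g * h"
    define s' where "s' = p' - g' * h'"
    have s: "(s, s') \<in> poly_rel R"
      unfolding s_def s'_def using h less.prems assms(2)
      by (intro poly_rel_diff poly_rel_mult)
    have "a \<noteq> 0"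
      using False assms(3) by (simp add: a_def)
    hence "h \<noteq> 0" "Polynomial.degree h = n"
      by (simp_all add: h_def degree_monom_eq)
    hence deg: "Polynomial.degree (g * h) = Polynomial.degree p"
      using False assms(3) by (simp add: degree_mult_eq n_def)
    have lead: "lead_coeff (g * h) = lead_coeff p"
      using \<open>Polynomial.degree h = n\<close> assms(3) by (simp add: lead_coeff_mult h_def a_def)
    \<comment> \<open>For constant \<open>p\<close> the difference \<open>s\<close> is zero and its
      degree is still 0, so the drop in degree has to allow \<open>s = 0\<close> as a separate
      case.\<close>
    have split: "s = 0 \<or> Polynomial.degree s < Polynomial.degree p"
    proof (rule ccontr)
      assume *: "\<not> (s = 0 \<or> Polynomial.degree s < Polynomial.degree p)"
      moreover have "Polynomial.degree s \<le> Polynomial.degree p"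
        unfolding s_def using degree_diff_le_max[of p "g * h"] deg by simp
      ultimately have "Polynomial.degree s = Polynomial.degree p"
        by simp
      moreover have "coeff s (Polynomial.degree p) = 0"
        using lead deg by (simp add: s_def)
      ultimately show False
        using * leading_coeff_0_iff[of s] by simp
    qed
    have "\<exists>q q' r r'. (q, q') \<in> poly_rel R \<and> (r, r') \<in> poly_rel R \<and> s = g * q + r \<and>
           s' = g' * q' + r' \<and> (r = 0 \<or> Polynomial.degree r < Polynomial.degree g)"
    proof (cases "s = 0")
      case True
      hence "s' = 0"
        using poly_rel_eq_zero_iff[OF s] by simp
      have "s = g * 0 + 0" "s' = g' * 0 + 0"
        using True \<open>s' = 0\<close> by simp_all
      with poly_rel_zero show ?thesis
        by blast
    next
      case False
      with split less.hyps[OF _ s] show ?thesis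
        by blast
    qed
    then obtain q q' r r' where qr: "(q, q') \<in> poly_rel R" "(r, r') \<in> poly_rel R"
      "s = g * q + r" "s' = g' * q' + r'" "r = 0 \<or> Polynomial.degree r < Polynomial.degree g"
      by blast
    have "p = g * (h + q) + r" "p' = g' * (h' + q') + r'"
      using qr(3,4) by (simp_all add: s_def s'_def algebra_simps)
    with qr h poly_rel_add show ?thesis
      by blast
  qed
qed

text \<open>Algebraicity over the domain of \<open>R\<close>: the partner \<open>q\<close> only
  certifies that all coefficients of \<open>p\<close> lie in the domain.\<close>

definition algebraic_elt :: "'k \<Rightarrow> bool" where
  "algebraic_elt a \<longleftrightarrow> (\<exists>(p, q) \<in> poly_rel R. p \<noteq> 0 \<and> poly p a = 0)"

text \<open>A nonzero annihilating polynomial of least degree plays the role of the minimal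
  polynomial; it need not be monic.\<close>

lemma minimal_poly_rel:
  assumes "algebraic_elt a"
  obtains m m' where "(m, m') \<in> poly_rel R" "m \<noteq> 0" "poly m a = 0"
    "\<And>p p'. \<lbrakk>(p, p') \<in> poly_rel R; poly p a = 0; Polynomial.degree p < Polynomial.degree m\<rbrakk> \<Longrightarrow> p = 0"
proof -
  let ?Q = "\<lambda>P. P \<in> poly_rel R \<and> fst P \<noteq> 0 \<and> poly (fst P) a = 0"
  obtain P where P: "?Q P"
    using assms by (fastforce simp: algebraic_elt_def)
  obtain M where M: "?Q M" "\<And>N. ?Q N \<Longrightarrow> Polynomial.degree (fst M) \<le> Polynomial.degree (fst N)"
    using ex_has_least_nat[of ?Q P "\<lambda>P. Polynomial.degree (fst P)", OF P] by blast
  show thesis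
  proof (rule that[of "fst M" "snd M"])
    fix p p' assume p: "(p, p') \<in> poly_rel R" "poly p a = 0"
      "Polynomial.degree p < Polynomial.degree (fst M)"
    thus "p = 0"
      using M(2)[of "(p, p')"] by auto
  qed (use M(1) in auto)
qed

text \<open>The values at \<open>a\<close> form a field, by a Euclidean descent on the degree of
  \<open>q\<close>. If \<open>q\<close> is too long, it is reduced modulo \<open>m\<close>, which
  keeps its value at \<open>a\<close>. Otherwise \<open>m = q * h + r\<close> gives
  \<open>r(a) = - q(a) h(a)\<close> with \<open>r\<close> shorter than \<open>q\<close>, and an
  inverse \<open>s(a)\<close> of \<open>r(a)\<close> yields the inverse \<open>- h(a) s(a)\<close>
  of \<open>q(a)\<close>.\<close>

lemma poly_rel_inverse:
  assumes alg: "algebraic_elt a" and q: "(q, q') \<in> poly_rel R" "poly q a \<noteq> 0"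
  shows "\<exists>s s'. (s, s') \<in> poly_rel R \<and> poly s a * poly q a = 1"
proof -
  obtain m m' where m: "(m, m') \<in> poly_rel R" "m \<noteq> 0" "poly m a = 0"
    "\<And>p p'. \<lbrakk>(p, p') \<in> poly_rel R; poly p a = 0; Polynomial.degree p < Polynomial.degree m\<rbrakk> \<Longrightarrow> p = 0"
    using minimal_poly_rel[OF alg] by blast
  show ?thesis
    using q
  proof (induction "Polynomial.degree q" arbitrary: q q' rule: less_induct)
    case less
    have q0: "q \<noteq> 0"
      using less.prems by auto
    show ?case
    proof (cases "Polynomial.degree q < Polynomial.degree m")
      case False
      obtain h h' r r' where hr: "(h, h') \<in> poly_rel R" "(r, r') \<in> poly_rel R" "q = m * h + r"
        "r = 0 \<or> Polynomial.degree r < Polynomial.degree m"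
        using poly_rel_division[OF less.prems(1) m(1,2)] by blast
      have "poly r a = poly q a"
        using hr(3) m(3) by simp
      moreover from this have "r \<noteq> 0"
        using less.prems(2) by auto
      ultimately show ?thesis
        using less.hyps[OF _ hr(2)] hr(4) False less.prems(2) by auto
    next
      case True
      show ?thesis
      proof (cases "Polynomial.degree q = 0")
        case True
        then obtain b where b: "q = [:b:]"
          by (meson degree_eq_zeroE)
        have "(b, coeff q' 0) \<in> R"
          using poly_relD[OF less.prems(1), of 0] b by simp
        hence "([:inverse b:], [:inverse (coeff q' 0):]) \<in> poly_rel R"
          by (intro poly_rel_const inv)
        moreover have "poly [:inverse b:] a * poly q a = 1"
          using b q0 by simp
        ultimately show ?thesis
          by blast
      next
        case pos: False
        obtain h h' r r' where hr: "(h, h') \<in> poly_rel R" "(r, r') \<in> poly_rel R" "m = q * h + r"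
          "r = 0 \<or> Polynomial.degree r < Polynomial.degree q"
          using poly_rel_division[OF m(1) less.prems(1) q0] by blast
        have ra: "poly r a = - (poly q a * poly h a)"
        proof -
          have "poly q a * poly h a + poly r a = 0"
            using m(3) hr(3) by simp
          thus ?thesis
            using minus_unique by metis
        qed
        \<comment> \<open>If \<open>q\<close> divided \<open>m\<close>, the cofactor
          \<open>h\<close> would vanish at \<open>a\<close> and, \<open>q\<close> not being
          constant, have smaller degree than \<open>m\<close>.\<close>
        have "r \<noteq> 0"
        proof
          assume "r = 0"
          hence mqh: "m = q * h"
            using hr(3) by simp
          hence "h \<noteq> 0" "poly h a = 0"
            using m(2,3) less.prems(2) by auto
          moreover have "Polynomial.degree h < Polynomial.degree m"
            using mqh q0 \<open>h \<noteq> 0\<close> pos by (simp add: degree_mult_eq)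
          ultimately show False
            using m(4)[OF hr(1)] by blast
        qed
        hence degr: "Polynomial.degree r < Polynomial.degree q"
          using hr(4) by blast
        hence "poly r a \<noteq> 0"
          using m(4)[OF hr(2)] \<open>r \<noteq> 0\<close> True by auto
        then obtain s s' where s: "(s, s') \<in> poly_rel R" "poly s a * poly r a = 1"
          using less.hyps[OF degr hr(2)] by blast
        have "(0 - h * s, 0 - h' * s') \<in> poly_rel R"
          by (intro poly_rel_diff poly_rel_zero poly_rel_mult hr s)
        moreover have "poly (0 - h * s) a * poly q a = 1"
          using s(2) by (simp add: ra algebra_simps)
        ultimately show ?thesis
          by blast
      qed
    qed
  qed
qed

section \<open>Adjoining an algebraic element\<close>

definition adjoin :: "'k \<Rightarrow> 'k \<Rightarrow> ('k \<times> 'k) set" where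
  "adjoin a b = {(poly p a, poly q b) | p q. (p, q) \<in> poly_rel R}"

lemma adjoinI: "(p, q) \<in> poly_rel R \<Longrightarrow> (poly p a, poly q b) \<in> adjoin a b"
  by (auto simp: adjoin_def)

lemma subset_adjoin: "R \<subseteq> adjoin a b"
proof
  fix z assume "z \<in> R"
  moreover obtain u v where "z = (u, v)"
    by fastforce
  ultimately show "z \<in> adjoin a b"
    using adjoinI[OF poly_rel_const, of u v a b] by simp
qed

lemma pair_in_adjoin: "(a, b) \<in> adjoin a b"
  using adjoinI[OF poly_rel_monom[OF one, of 1], of a b] by (simp add: poly_monom)

text \<open>The hypothesis \<open>vanish\<close> makes \<open>a \<mapsto> b\<close> well defined.
  Injectivity and inverses come from the field property: if \<open>s(a)\<close> inverts
  \<open>p(a)\<close>, then \<open>s * p - 1\<close> vanishes at \<open>a\<close>, so its partner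
  vanishes at \<open>b\<close>, and \<open>s'(b)\<close> inverts \<open>q(b)\<close>.\<close>

lemma partial_iso_adjoin:
  assumes alg: "algebraic_elt a"
    and vanish: "\<And>p q. \<lbrakk>(p, q) \<in> poly_rel R; poly p a = 0\<rbrakk> \<Longrightarrow> poly q b = 0"
  shows "partial_iso (adjoin a b)"
proof -
  have unit: "\<exists>s s'. (s, s') \<in> poly_rel R \<and> poly s a * poly p a = 1 \<and> poly s' b * poly q b = 1"
    if pq: "(p, q) \<in> poly_rel R" "poly p a \<noteq> 0" for p q
  proof -
    obtain s s' where s: "(s, s') \<in> poly_rel R" "poly s a * poly p a = 1"
      using poly_rel_inverse[OF alg pq] by blast
    have "(s * p - [:1:], s' * q - [:1:]) \<in> poly_rel R"
      by (intro poly_rel_diff poly_rel_mult poly_rel_const s pq one)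
    from vanish[OF this] s show ?thesis
      by auto
  qed
  show ?thesis
  proof (rule partial_isoI)
    show "(1, 1) \<in> adjoin a b"
      using one subset_adjoin by blast
  next
    fix u v u' v' assume "(u, v) \<in> adjoin a b" "(u', v') \<in> adjoin a b"
    then obtain p q p' q' where *: "u = poly p a" "v = poly q b" "u' = poly p' a" "v' = poly q' b"
      "(p, q) \<in> poly_rel R" "(p', q') \<in> poly_rel R"
      by (auto simp: adjoin_def)
    show "(u - u', v - v') \<in> adjoin a b" "(u * u', v * v') \<in> adjoin a b"
      using adjoinI[OF poly_rel_diff[OF *(5,6)], of a b]
        adjoinI[OF poly_rel_mult[OF *(5,6)], of a b] * by simp_all
  next
    fix u v assume "(u, v) \<in> adjoin a b"
    then obtain p q where *: "u = poly p a" "v = poly q b" "(p, q) \<in> poly_rel R"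
      by (auto simp: adjoin_def)
    show "u = 0 \<longleftrightarrow> v = 0"
      using vanish[OF *(3)] unit[OF *(3)] * by (metis mult_zero_right zero_neq_one)
    show "(inverse u, inverse v) \<in> adjoin a b"
    proof (cases "u = 0")
      case True
      hence "v = 0"
        using vanish[OF *(3)] * by simp
      with True show ?thesis
        using zero subset_adjoin by auto
    next
      case False
      then obtain s s' where s: "(s, s') \<in> poly_rel R" "poly s a * u = 1" "poly s' b * v = 1"
        using unit[OF *(3)] * by blast
      hence "inverse u = poly s a" "inverse v = poly s' b"
        by (metis inverse_unique mult.commute)+
      thus ?thesis
        using adjoinI[OF s(1)] by simp
    qed
  qed
qed

text \<open>Any root \<open>b\<close> of the partner \<open>m'\<close> of the minimal polynomial
  will do: a polynomial vanishing at \<open>a\<close> is a multiple of \<open>m\<close>, and the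
  parallel division makes its partner a multiple of \<open>m'\<close>.\<close>

lemma conjugate_exists:
  assumes closed: "\<And>p :: 'k poly. Polynomial.degree p > 0 \<Longrightarrow> \<exists>z. poly p z = 0"
    and alg: "algebraic_elt a"
  shows "\<exists>b. \<forall>(p, q) \<in> poly_rel R. poly p a = 0 \<longrightarrow> poly q b = 0"
proof -
  obtain m m' where m: "(m, m') \<in> poly_rel R" "m \<noteq> 0" "poly m a = 0"
    "\<And>p p'. \<lbrakk>(p, p') \<in> poly_rel R; poly p a = 0; Polynomial.degree p < Polynomial.degree m\<rbrakk> \<Longrightarrow> p = 0"
    using minimal_poly_rel[OF alg] by blast
  have "Polynomial.degree m > 0"
    using m(2,3) by (cases "Polynomial.degree m = 0") (auto elim: degree_eq_zeroE)
  then obtain b where b: "poly m' b = 0"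
    using closed poly_rel_degree[OF m(1)] by metis
  have "poly q b = 0" if pq: "(p, q) \<in> poly_rel R" "poly p a = 0" for p q
  proof -
    obtain h h' r r' where hr: "(h, h') \<in> poly_rel R" "(r, r') \<in> poly_rel R" "p = m * h + r"
      "q = m' * h' + r'" "r = 0 \<or> Polynomial.degree r < Polynomial.degree m"
      using poly_rel_division[OF pq(1) m(1,2)] by blast
    have "poly r a = 0"
      using hr(3) pq(2) m(3) by simp
    hence "r = 0"
      using m(4)[OF hr(2)] hr(5) by blast
    hence "r' = 0"
      using poly_rel_eq_zero_iff[OF hr(2)] by simp
    thus ?thesis
      using hr(4) b by simp
  qed
  thus ?thesis
    by blast
qed

end

section \<open>Maximal partial isomorphisms\<close>

lemma partial_iso_Union:
  assumes "\<And>R. R \<in> \<C> \<Longrightarrow> partial_iso R" and "\<C> \<noteq> {}"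
    and chain: "\<And>R T. \<lbrakk>R \<in> \<C>; T \<in> \<C>\<rbrakk> \<Longrightarrow> R \<subseteq> T \<or> T \<subseteq> R"
  shows "partial_iso (\<Union>\<C>)"
proof -
  \<comment> \<open>The axioms speak of at most two pairs at a time, and two pairs of the union lie
    in one member of the chain.\<close>
  have common: "\<exists>R\<in>\<C>. z \<in> R \<and> z' \<in> R" if "z \<in> \<Union>\<C>" "z' \<in> \<Union>\<C>" for z z'
    using that chain by blast
  show ?thesis
  proof (rule partial_isoI)
    show "(1, 1) \<in> \<Union>\<C>"
      using assms(1,2) partial_hom.one[OF partial_iso.axioms(1)] by (meson UnionI equals0I)
  next
    fix a b a' b' assume "(a, b) \<in> \<Union>\<C>" "(a', b') \<in> \<Union>\<C>"
    then obtain R where R: "R \<in> \<C>" "(a, b) \<in> R" "(a', b') \<in> R"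
      using common by blast
    then interpret partial_iso R
      using assms(1) by blast
    show "(a - a', b - b') \<in> \<Union>\<C>" "(a * a', b * b') \<in> \<Union>\<C>"
      using R diff mult by blast+
  next
    fix a b assume "(a, b) \<in> \<Union>\<C>"
    then obtain R where R: "R \<in> \<C>" "(a, b) \<in> R"
      by blast
    then interpret partial_iso R
      using assms(1) by blast
    show "(inverse a, inverse b) \<in> \<Union>\<C>" "a = 0 \<longleftrightarrow> b = 0"
      using R inv eq_zero_iff by blast+
  qed
qed

lemma maximal_partial_iso:
  assumes "partial_iso R"
  obtains M where "partial_iso M" "R \<subseteq> M" "\<And>T. \<lbrakk>partial_iso T; M \<subseteq> T\<rbrakk> \<Longrightarrow> T = M"
proof -
  let ?A = "{T. partial_iso T \<and> R \<subseteq> T}"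
  have "\<exists>M\<in>?A. \<forall>T\<in>?A. M \<subseteq> T \<longrightarrow> T = M"
  proof (rule subset_Zorn_nonempty)
    show "?A \<noteq> {}"
      using assms by blast
  next
    fix \<C> assume \<C>: "\<C> \<noteq> {}" "subset.chain ?A \<C>"
    hence "partial_iso (\<Union>\<C>)"
      by (intro partial_iso_Union) (auto simp: subset_chain_def)
    moreover have "R \<subseteq> \<Union>\<C>"
      using \<C> unfolding subset_chain_def by blast
    ultimately show "\<Union>\<C> \<in> ?A"
      by simp
  qed
  then obtain M where "M \<in> ?A" "\<forall>T\<in>?A. M \<subseteq> T \<longrightarrow> T = M"
    by blast
  with that show thesis
    by blast
qed

text \<open>Algebraic closedness supplies a conjugate \<open>b\<close> of \<open>a\<close>;
  adjoining \<open>a \<mapsto> b\<close> extends \<open>M\<close>, so by maximality the pair is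
  already in \<open>M\<close>.\<close>

lemma algebraic_in_Domain_maximal:
  fixes M :: "('k::field \<times> 'k) set"
  assumes "partial_iso M" and max: "\<And>T. \<lbrakk>partial_iso T; M \<subseteq> T\<rbrakk> \<Longrightarrow> T = M"
    and closed: "\<And>p :: 'k poly. Polynomial.degree p > 0 \<Longrightarrow> \<exists>z. poly p z = 0"
    and p: "p \<noteq> 0" "\<And>i. coeff p i \<in> Domain M" "poly p a = 0"
  shows "a \<in> Domain M"
proof -
  interpret partial_iso M by fact
  \<comment> \<open>A choice of images on the domain produces a partner for \<open>p\<close>. The
    value \<open>f 0 = 0\<close> matters because \<open>map_poly\<close> leaves the coefficients
    beyond the degree at zero.\<close>
  obtain f where f: "\<And>d. d \<in> Domain M \<Longrightarrow> (d, f d) \<in> M"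
  proof (rule that)
    show "(d, SOME e. (d, e) \<in> M) \<in> M" if "d \<in> Domain M" for d
      using that by (auto intro: someI)
  qed
  have f0: "f 0 = 0"
    using f[of 0] zero eq_zero_iff by blast
  have "(p, map_poly f p) \<in> poly_rel M"
    using f p(2) f0 by (simp add: poly_rel_def coeff_map_poly)
  hence alg: "algebraic_elt a"
    using p by (auto simp: algebraic_elt_def)
  obtain b where b: "\<And>p q. \<lbrakk>(p, q) \<in> poly_rel M; poly p a = 0\<rbrakk> \<Longrightarrow> poly q b = 0"
    using conjugate_exists[OF closed alg] by blast
  have "adjoin a b = M"
    using max[OF partial_iso_adjoin[OF alg b] subset_adjoin] .
  thus ?thesis
    using pair_in_adjoin by blast
qed

text \<open>The converse of a maximal partial isomorphism is again maximal, so the result on domains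
  applies to it.\<close>

lemma algebraic_in_Range_maximal:
  fixes M :: "('k::field \<times> 'k) set"
  assumes "partial_iso M" and max: "\<And>T. \<lbrakk>partial_iso T; M \<subseteq> T\<rbrakk> \<Longrightarrow> T = M"
    and closed: "\<And>p :: 'k poly. Polynomial.degree p > 0 \<Longrightarrow> \<exists>z. poly p z = 0"
    and p: "p \<noteq> 0" "\<And>i. coeff p i \<in> Range M" "poly p a = 0"
  shows "a \<in> Range M"
proof -
  have "a \<in> Domain (M\<inverse>)"
  proof (rule algebraic_in_Domain_maximal[OF _ _ closed p(1) _ p(3)])
    show "partial_iso (M\<inverse>)"
      using assms(1) by (rule partial_iso.partial_iso_converse)
    fix T assume T: "partial_iso T" "M\<inverse> \<subseteq> T"
    have "T\<inverse> = M"
      by (rule max[OF partial_iso.partial_iso_converse[OF T(1)]]) (use T(2) in auto)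
    thus "T = M\<inverse>"
      by (metis converse_converse)
  qed (use p(2) in auto)
  thus ?thesis
    by simp
qed

subsection \<open>Generated subfields and algebraic closures of type-class fields\<close>

lemma ring_of_type_algebra_simps [simp]:
  "carrier ring_of_type_algebra = UNIV"
  "\<one>\<^bsub>ring_of_type_algebra\<^esub> = 1"
  "\<zero>\<^bsub>ring_of_type_algebra\<^esub> = 0"
  "a \<otimes>\<^bsub>ring_of_type_algebra\<^esub> b = a * b"
  "a \<oplus>\<^bsub>ring_of_type_algebra\<^esub> b = a + b"
  by (simp_all add: ring_of_type_algebra_def)

lemma a_inv_ring_of_type_algebra [simp]:
  fixes a :: "'k::field"
  shows "\<ominus>\<^bsub>ring_of_type_algebra\<^esub> a = - a"
proof -
  interpret field "ring_of_type_algebra :: 'k ring"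
    by (rule field_from_type_algebra)
  show ?thesis
    by (rule minus_equality) simp_all
qed

lemma m_inv_ring_of_type_algebra [simp]:
  fixes a :: "'k::field"
  assumes "a \<noteq> 0"
  shows "inv\<^bsub>ring_of_type_algebra\<^esub> a = inverse a"
proof -
  interpret field "ring_of_type_algebra :: 'k ring"
    by (rule field_from_type_algebra)
  show ?thesis
    by (rule comm_inv_char) (use assms in simp_all)
qed

lemma field_gen_incl: "a \<in> A \<Longrightarrow> a \<in> field_gen A"
  unfolding field_gen_def by (rule generate_field.incl)

text \<open>Subfields are encoded by their identity relations: \<open>Id_on H\<close> is a partial
  isomorphism exactly when \<open>H\<close> is a subfield.\<close>

lemma partial_iso_field_gen: "partial_iso (Id_on (field_gen (A :: 'k::field set)))"
proof (rule partial_isoI)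
  let ?K = "ring_of_type_algebra :: 'k ring"
  show "(1, 1) \<in> Id_on (field_gen A)"
    using generate_field.one[of ?K A] by (simp add: field_gen_def Id_on_iff)
  fix a b a' b' assume *: "(a, b) \<in> Id_on (field_gen A)" "(a', b') \<in> Id_on (field_gen A)"
  show "(a - a', b - b') \<in> Id_on (field_gen A)"
    using * generate_field.eng_add[OF _ generate_field.a_inv, of a ?K A a']
    by (auto simp: field_gen_def)
  show "(a * a', b * b') \<in> Id_on (field_gen A)"
    using * generate_field.eng_mult[of a ?K A a'] by (auto simp: field_gen_def)
next
  let ?K = "ring_of_type_algebra :: 'k ring"
  fix a b assume *: "(a, b) \<in> Id_on (field_gen A)"
  show "(inverse a, inverse b) \<in> Id_on (field_gen A)"
    using * generate_field.m_inv[of a ?K A] by (cases "a = 0") (auto simp: field_gen_def)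
qed auto

lemma field_gen_subset:
  fixes A H :: "'k::field set"
  assumes "partial_iso (Id_on H)" "A \<subseteq> H"
  shows "field_gen A \<subseteq> H"
proof
  interpret partial_iso "Id_on H" by fact
  fix a assume "a \<in> field_gen A"
  thus "a \<in> H"
    unfolding field_gen_def
  proof (induction rule: generate_field.induct)
    case one
    show ?case
      using partial_hom.one[OF partial_iso.axioms(1)[OF assms(1)]] by (simp add: Id_on_iff)
  next
    case (incl h)
    thus ?case
      using assms(2) by blast
  next
    case (a_inv h)
    thus ?case
      using uminus[of h h] by auto
  next
    case (m_inv h)
    thus ?case
      using inv[of h h] by auto
  next
    case (eng_add h1 h2)
    thus ?case
      using add[of h1 h1 h2 h2] by auto
  next
    case (eng_mult h1 h2)
    thus ?case
      using mult[of h1 h1 h2 h2] by auto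
  qed
qed

text \<open>The list polynomials of HOL-Algebra start with the leading coefficient, whereas
  \<open>Poly\<close> starts with the constant one; hence the reversal.\<close>

lemma eval_eq_poly:
  "ring.eval (ring_of_type_algebra :: 'k::field ring) xs a = poly (Poly (rev xs)) a"
proof -
  interpret field "ring_of_type_algebra :: 'k ring"
    by (rule field_from_type_algebra)
  have pow: "a [^]\<^bsub>ring_of_type_algebra\<^esub> n = a ^ n" for n :: nat
    by (induction n) simp_all
  show ?thesis
    by (induction xs) (simp_all add: Poly_append poly_monom pow add.commute)
qed

text \<open>Every polynomial over the carrier splits, so its multiset of roots has the size of its
  degree and is nonempty for positive degree.\<close>

lemma algebraic_closure_root:
  fixes p :: "'k::field poly"
  assumes "algebraic_closure (ring_of_type_algebra :: 'k ring) F" "Polynomial.degree p > 0"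
  shows "\<exists>z. poly p z = 0"
proof -
  interpret algebraic_closure "ring_of_type_algebra :: 'k ring" F by fact
  define P where "P = rev (coeffs p)"
  have "p \<noteq> 0"
    using assms(2) by auto
  have P: "P \<in> carrier (poly_ring (ring_of_type_algebra :: 'k ring))"
    using \<open>p \<noteq> 0\<close> by (auto simp: univ_poly_def polynomial_def P_def hd_rev last_coeffs_eq_coeff_degree)
  have "splitted P"
    using roots_over_carrier[OF P] .
  hence "roots P \<noteq> {#}"
    using assms(2) by (auto simp: splitted_def P_def degree_eq_length_coeffs)
  then obtain z where "z \<in># roots P"
    by blast
  hence "is_root P z"
    using roots_mem_iff_is_root[OF P] by auto
  hence "eval P z = 0"
    by (simp add: is_root_def)
  thus ?thesis
    by (auto simp: eval_eq_poly P_def)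
qed

lemma algebraic_closure_algebraic:
  fixes a :: "'k::field"
  assumes "algebraic_closure (ring_of_type_algebra :: 'k ring) F"
  shows "\<exists>p. p \<noteq> 0 \<and> (\<forall>i. coeff p i \<in> F) \<and> poly p a = 0"
proof -
  interpret algebraic_closure "ring_of_type_algebra :: 'k ring" F by fact
  have "(algebraic over F) a"
    by (rule algebraic_extension) simp
  then obtain P where P: "P \<in> carrier (F[X]\<^bsub>ring_of_type_algebra\<^esub>)" "P \<noteq> []" "eval P a = 0"
    using algebraicE[OF subfieldE(1)[OF subfield_axioms], of a]
    by (auto simp: over_def)
  have poly: "set P \<subseteq> F" "hd P \<noteq> 0"
    using P(1,2) by (auto simp: univ_poly_def polynomial_def)
  have "0 \<in> F"
    using subringE(2)[OF subfieldE(1)[OF subfield_axioms]] by simp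
  have "last (rev P) \<noteq> 0"
    using poly P(2) by (simp add: last_rev)
  \<comment> \<open>The nonzero leading entry of \<open>P\<close> comes last in
    \<open>rev P\<close>, so \<open>Poly\<close> strips nothing and the result is not the zero
    polynomial.\<close>
  hence "coeffs (Poly (rev P)) = rev P"
    by (metis coeffs_Poly no_trailing_unfold strip_while_idem_iff)
  hence "Poly (rev P) \<noteq> 0"
    using P(2) by (metis coeffs_eq_Nil rev_is_Nil_conv)
  moreover have "poly.coeff (Poly (rev P)) i \<in> F" for i
    using poly(1) \<open>0 \<in> F\<close> nth_mem[of i "rev P"] by (auto simp: nth_default_def)
  ultimately show ?thesis
    using P(3) by (auto simp: eval_eq_poly)
qed

subsection \<open>Extending a conjugation to an automorphism\<close>

text \<open>These are total maps of the ambient field, in contrast to the extensional elements of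
  \<open>field_Aut\<close>; they are restricted to the orbit field later.\<close>

definition field_automorphism :: "('k::field \<Rightarrow> 'k) \<Rightarrow> bool" where
  "field_automorphism \<sigma> \<longleftrightarrow> bij \<sigma> \<and> (\<forall>a b. \<sigma> (a + b) = \<sigma> a + \<sigma> b) \<and> (\<forall>a b. \<sigma> (a * b) = \<sigma> a * \<sigma> b)"

lemma (in partial_iso) partial_iso_Id_on_Domain: "partial_iso (Id_on (Domain R))"
proof (rule partial_isoI)
  show "(1, 1) \<in> Id_on (Domain R)"
    using one by auto
  fix a b a' b' assume "(a, b) \<in> Id_on (Domain R)" "(a', b') \<in> Id_on (Domain R)"
  then obtain d d' where d: "(a, d) \<in> R" "(a', d') \<in> R" "a = b" "a' = b'"
    by auto
  show "(a - a', b - b') \<in> Id_on (Domain R)" "(a * a', b * b') \<in> Id_on (Domain R)"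
    using diff[OF d(1,2)] mult[OF d(1,2)] d(3,4) by auto
qed (auto dest: inv)

text \<open>The isomorphism \<open>a \<mapsto> b\<close> over \<open>F\<close> is extended to a
  maximal one. Its domain contains \<open>F\<close> and \<open>a\<close>, over which every element
  is algebraic, so it is everything; the same holds for its range once \<open>a\<close> is found
  there.\<close>

lemma automorphism_extending_conjugation:
  fixes F :: "'k::field set"
  assumes F: "partial_iso (Id_on F)"
    and closed: "\<And>p :: 'k poly. Polynomial.degree p > 0 \<Longrightarrow> \<exists>z. poly p z = 0"
    and algebraic: "\<And>z. \<exists>p. p \<noteq> 0 \<and> (\<forall>i. coeff p i \<in> field_gen (insert a F)) \<and> poly p z = 0"
    and m: "m \<noteq> 0" "\<And>i. coeff m i \<in> F" "poly m a = 0"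
    and conjugate: "\<And>p. \<lbrakk>\<And>i. coeff p i \<in> F; poly p a = 0\<rbrakk> \<Longrightarrow> poly p b = 0"
  obtains \<sigma> where "field_automorphism \<sigma>" "\<And>z. z \<in> F \<Longrightarrow> \<sigma> z = z" "\<sigma> a = b"
proof -
  interpret F: partial_iso "Id_on F" by fact
  have rel: "(p, q) \<in> poly_rel (Id_on F) \<longleftrightarrow> p = q \<and> (\<forall>i. coeff p i \<in> F)" for p q
    by (auto simp: poly_rel_def poly_eq_iff Id_on_iff)
  have alg: "F.algebraic_elt a"
    unfolding F.algebraic_elt_def using m by (auto intro!: bexI[of _ "(m, m)"] simp: rel)
  have "partial_iso (F.adjoin a b)"
    using alg conjugate by (intro F.partial_iso_adjoin) (auto simp: rel)
  then obtain M where M: "partial_iso M" "F.adjoin a b \<subseteq> M"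
    and max: "\<And>T. \<lbrakk>partial_iso T; M \<subseteq> T\<rbrakk> \<Longrightarrow> T = M"
    using maximal_partial_iso by blast
  interpret M: partial_iso M by fact
  have F_M: "Id_on F \<subseteq> M" and ab: "(a, b) \<in> M"
    using M(2) F.subset_adjoin F.pair_in_adjoin by blast+
  have dom: "z \<in> Domain M" for z
  proof -
    have "field_gen (insert a F) \<subseteq> Domain M"
      using F_M ab by (intro field_gen_subset M.partial_iso_Id_on_Domain) auto
    with algebraic[of z] show ?thesis
      using algebraic_in_Domain_maximal[OF M(1) max closed] by blast
  qed
  have ran: "z \<in> Range M" for z
  proof -
    have "F \<subseteq> Range M"
      using F_M by auto
    \<comment> \<open>The construction only places \<open>b\<close> in the range; \<open>a\<close>
      lies there because it is algebraic over \<open>F\<close> and the range contains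
      \<open>F\<close>.\<close>
    hence "a \<in> Range M"
      using algebraic_in_Range_maximal[OF M(1) max closed m(1) _ m(3)] m(2) by blast
    have "field_gen (insert a F) \<subseteq> Domain (M\<inverse>)"
      using \<open>F \<subseteq> Range M\<close> \<open>a \<in> Range M\<close>
      by (intro field_gen_subset partial_iso.partial_iso_Id_on_Domain M.partial_iso_converse) simp
    with algebraic[of z] show ?thesis
      using algebraic_in_Range_maximal[OF M(1) max closed] by (metis Domain_converse subsetD)
  qed
  define \<sigma> where "\<sigma> z = (THE u. (z, u) \<in> M)" for z
  have \<sigma>: "(z, u) \<in> M \<longleftrightarrow> \<sigma> z = u" for z u
  proof -
    obtain u' where "(z, u') \<in> M"
      using dom[of z] by blast
    moreover from this have "\<sigma> z = u'"
      unfolding \<sigma>_def using M.single_valued by blast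
    ultimately show ?thesis
      using M.single_valued by blast
  qed
  show thesis
  proof (rule that)
    have "inj \<sigma>"
      using M.injective \<sigma> by (metis injI)
    moreover have "surj \<sigma>"
      using ran \<sigma> by (metis RangeE surj_def)
    ultimately show "field_automorphism \<sigma>"
      unfolding field_automorphism_def bij_def using M.add M.mult by (simp add: \<sigma>)
    show "\<sigma> z = z" if "z \<in> F" for z
      using F_M that \<sigma> by auto
    show "\<sigma> a = b"
      using ab \<sigma> by simp
  qed
qed

subsection \<open>Specialisation of two independent elements\<close>

lemma poly_map_poly_add:
  assumes "h 0 = 0" "\<And>a b. h (a + b) = h a + h b"
  shows "poly (map_poly h (p + q)) z = poly (map_poly h p) z + poly (map_poly h q) z"
proof -
  have "map_poly h (p + q) = map_poly h p + map_poly h q"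
    by (rule poly_eqI) (simp add: coeff_map_poly assms)
  thus ?thesis
    by simp
qed

lemma poly_map_poly_mult:
  fixes h :: "'a::comm_ring_1 \<Rightarrow> 'b::comm_ring_1"
  assumes h: "h 0 = 0" "\<And>a b. h (a + b) = h a + h b" "\<And>a b. h (a * b) = h a * h b"
  shows "poly (map_poly h (p * q)) z = poly (map_poly h p) z * poly (map_poly h q) z"
proof (induction p)
  case 0
  show ?case
    by simp
next
  case (pCons a p)
  have "map_poly h (smult a q) = smult (h a) (map_poly h q)"
    by (rule poly_eqI) (simp add: coeff_map_poly h)
  thus ?case
    using pCons by (simp add: poly_map_poly_add h map_poly_pCons algebra_simps)
qed

text \<open>The fixed elements form a field even when the domain does not: a nonzero fixed element
  has a nonzero image, namely itself, and is therefore invertible in the domain.\<close>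

lemma (in partial_hom) partial_iso_fixed: "partial_iso (Id_on {a. (a, a) \<in> R})"
proof (rule partial_isoI)
  show "(1, 1) \<in> Id_on {a. (a, a) \<in> R}"
    by (simp add: Id_on_iff one)
  fix a b assume "(a, b) \<in> Id_on {a. (a, a) \<in> R}"
  thus "(inverse a, inverse b) \<in> Id_on {a. (a, a) \<in> R}"
    using inverse_unit[of a a] zero by (cases "a = 0") (auto simp: Id_on_iff)
qed (auto simp: Id_on_iff diff mult)

lemma (in partial_hom) poly_fixed:
  assumes "\<And>i. (coeff p i, coeff p i) \<in> R" "(a, b) \<in> R"
  shows "(poly p a, poly p b) \<in> R"
  unfolding poly_altdef using assms by (intro sum mult power)

text \<open>Definedness is demanded at the image pair, since negative powers are available as soon
  as the image is nonzero.\<close>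

lemma (in partial_hom) step_poly_rel:
  assumes "\<And>z. (c z, c z) \<in> R" "(u, u') \<in> R" "(v, v') \<in> R" "step_defined \<S> (u', v')"
  shows "(step_poly c \<S> w (u, v), step_poly c \<S> w (u', v')) \<in> R"
proof -
  have "(\<Sum>s\<in>\<S>. c (w s) * u powi (fst s) * v powi (snd s),
         \<Sum>s\<in>\<S>. c (w s) * u' powi (fst s) * v' powi (snd s)) \<in> R"
    using assms by (intro sum mult power_int) (auto simp: step_defined_def)
  thus ?thesis
    by (simp add: step_poly_def case_prod_unfold)
qed

section \<open>Clearing denominators in Laurent polynomials\<close>

lemma laurent_shift:
  fixes e :: "'i \<Rightarrow> int"
  assumes "finite I"
  obtains N :: nat where "\<And>s. s \<in> I \<Longrightarrow> e s + int N \<ge> 0"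
proof (rule that)
  fix s assume "s \<in> I"
  hence "\<bar>e s\<bar> \<le> (\<Sum>s\<in>I. \<bar>e s\<bar>)"
    using assms by (intro member_le_sum) auto
  \<comment> \<open>The shift \<open>N\<close> is the sum of all absolute exponents, which bounds
    each of them.\<close>
  thus "e s + int (nat (\<Sum>s\<in>I. \<bar>e s\<bar>)) \<ge> 0"
    by (simp add: sum_nonneg)
qed

lemma power_int_shift:
  fixes y :: "'k::field"
  assumes "y \<noteq> 0" "i + int N \<ge> 0"
  shows "y ^ nat (i + int N) = y powi i * y ^ N"
proof -
  have "y ^ nat (i + int N) = y powi (i + int N)"
    using assms(2) by (simp add: power_int_def)
  also have "\<dots> = y powi i * y ^ N"
    using assms(1) by (simp add: power_int_add)
  finally show ?thesis .
qed

text \<open>Multiplying the equation by \<open>y ^ N\<close> turns it into a polynomial equation.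
  Its coefficient at \<open>j + N\<close> collects the \<open>a s\<close> with
  \<open>f s = j\<close>; the constant \<open>t\<close> sits at \<open>N\<close> and, as
  \<open>j \<noteq> 0\<close>, cannot cancel it.\<close>

lemma laurent_root_algebraic:
  fixes y t :: "'k::field" and f :: "'i \<Rightarrow> int"
  assumes F: "partial_iso (Id_on F)" and "finite I" "y \<noteq> 0" "\<And>s. s \<in> I \<Longrightarrow> a s \<in> F" "t \<in> F"
    and root: "(\<Sum>s\<in>I. a s * y powi f s) = t"
    and j: "j \<noteq> 0" "(\<Sum>s | s \<in> I \<and> f s = j. a s) \<noteq> 0"
  shows "\<exists>m. m \<noteq> 0 \<and> (\<forall>i. coeff m i \<in> F) \<and> poly m y = 0"
proof -
  interpret F: partial_iso "Id_on F" by fact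
  obtain N :: nat where N: "\<And>s. s \<in> I \<Longrightarrow> f s + int N \<ge> 0"
    using laurent_shift[OF \<open>finite I\<close>] by blast
  define m where "m = (\<Sum>s\<in>I. monom (a s) (nat (f s + int N))) - monom t N"
  have coeff_m: "coeff m i =
      (\<Sum>s\<in>I. if nat (f s + int N) = i then a s else 0) - (if N = i then t else 0)" for i
    by (simp add: m_def coeff_sum)
  have "(coeff m i, coeff m i) \<in> Id_on F" for i
    unfolding coeff_m using F.zero assms(4,5)
    by (intro F.diff F.sum) (auto simp: Id_on_iff)
  hence "\<forall>i. coeff m i \<in> F"
    by blast
  moreover have "poly m y = 0"
  proof -
    have "poly m y = (\<Sum>s\<in>I. a s * (y powi f s * y ^ N)) - t * y ^ N"
      using N \<open>y \<noteq> 0\<close> by (simp add: m_def poly_sum poly_monom power_int_shift)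
    also have "\<dots> = 0"
      by (simp add: root[symmetric] sum_distrib_right mult.assoc)
    finally show ?thesis .
  qed
  moreover have "m \<noteq> 0"
  proof -
    have "{s \<in> I. f s = j} \<noteq> {}"
      using j(2) by (metis sum.empty)
    hence jN: "j + int N \<ge> 0"
      using N by blast
    have "nat (f s + int N) = nat (j + int N) \<longleftrightarrow> f s = j" if "s \<in> I" for s
      using N[OF that] jN by auto
    moreover have "N \<noteq> nat (j + int N)"
      using j(1) jN by auto
    ultimately have "coeff m (nat (j + int N)) = (\<Sum>s\<in>I. if f s = j then a s else 0)"
      by (simp add: coeff_m cong: sum.cong)
    also have "\<dots> = (\<Sum>s | s \<in> I \<and> f s = j. a s)"
      using \<open>finite I\<close> by (rule sum.inter_filter[symmetric])
    finally show ?thesis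
      using j(2) by auto
  qed
  ultimately show ?thesis
    by blast
qed

section \<open>Polynomials in two variables and their specialisations\<close>

locale walk =
  fixes c :: "complex \<Rightarrow> 'k::field"
    and \<S> :: "(int \<times> int) set"
    and w :: "int \<times> int \<Rightarrow> complex"
    and x y :: 'k
  assumes finite_steps: "finite \<S>"
    and weights: "\<forall>s\<in>\<S>. w s \<noteq> 0"
    and not_univariate: "not_univariate \<S>"
    and c_hom: "c \<in> ring_hom (ring_of_type_algebra :: complex ring) (ring_of_type_algebra :: 'k ring)"
    and indep: "alg_indep2 c x y"
    and closure: "algebraic_closure (ring_of_type_algebra :: 'k ring) (field_gen (range c \<union> {x, y}))"
begin

lemma c_simps: "c (a + b) = c a + c b" "c (a * b) = c a * c b" "c 1 = 1" "c 0 = 0"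
proof -
  show add: "c (a + b) = c a + c b" for a b
    using ring_hom_add[OF c_hom, of a b] by simp
  show "c (a * b) = c a * c b" "c 1 = 1"
    using ring_hom_mult[OF c_hom, of a b] ring_hom_one[OF c_hom] by simp_all
  show "c 0 = 0"
    using add[of 0 0] by (metis add_0 add_right_cancel)
qed

text \<open>The inner indeterminate goes to \<open>u\<close> and the outer one to \<open>v\<close>,
  in the order of \<open>alg_indep2\<close>.\<close>

definition eval2 :: "'k \<Rightarrow> 'k \<Rightarrow> complex poly poly \<Rightarrow> 'k" where
  "eval2 u v P = poly (map_poly (\<lambda>q. poly (map_poly c q) u) P) v"

lemma eval2_add: "eval2 u v (P + Q) = eval2 u v P + eval2 u v Q"
  by (simp add: eval2_def poly_map_poly_add c_simps)

lemma eval2_mult: "eval2 u v (P * Q) = eval2 u v P * eval2 u v Q"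
  unfolding eval2_def
  by (rule poly_map_poly_mult) (simp_all add: poly_map_poly_add poly_map_poly_mult c_simps)

lemma eval2_diff: "eval2 u v (P - Q) = eval2 u v P - eval2 u v Q"
  using eval2_add[of u v "P - Q" Q] by simp

lemma eval2_simps [simp]:
  "eval2 u v 0 = 0" "eval2 u v [:[:a:]:] = c a" "eval2 u v [:[:0, 1:]:] = u" "eval2 u v [:0, 1:] = v"
  "eval2 u v 1 = 1"
  by (simp_all add: eval2_def map_poly_pCons c_simps one_pCons)

lemma eval2_eq_0_iff: "eval2 x y P = 0 \<longleftrightarrow> P = 0"
  using indep by (auto simp: alg_indep2_def eval2_def)

text \<open>
  The substitution of \<open>(u, v)\<close> for \<open>(x, y)\<close>, on the quotients whose denominator survives it.
\<close>

definition specialisation :: "'k \<Rightarrow> 'k \<Rightarrow> ('k \<times> 'k) set" where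
  "specialisation u v =
     {(eval2 x y P / eval2 x y Q, eval2 u v P / eval2 u v Q) | P Q. eval2 u v Q \<noteq> 0}"

lemma specialisationI:
  "eval2 u v Q \<noteq> 0 \<Longrightarrow>
     (eval2 x y P / eval2 x y Q, eval2 u v P / eval2 u v Q) \<in> specialisation u v"
  by (auto simp: specialisation_def)

lemma eval2_in_specialisation: "(eval2 x y P, eval2 u v P) \<in> specialisation u v"
  using specialisationI[of u v 1 P] by simp

text \<open>A denominator that survives at \<open>(u, v)\<close> is a nonzero polynomial, hence
  nonzero at \<open>(x, y)\<close> by independence. Independence also gives
  \<open>zero_left\<close>: a numerator vanishing at \<open>(x, y)\<close> is the zero polynomial,
  so the image does not depend on the fraction chosen.\<close>

lemma partial_hom_specialisation: "partial_hom (specialisation u v)"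
proof
  show "(1, 1) \<in> specialisation u v"
    using eval2_in_specialisation[of 1 u v] by simp
next
  fix a b a' b' assume "(a, b) \<in> specialisation u v" "(a', b') \<in> specialisation u v"
  then obtain P Q P' Q' where PQ: "a = eval2 x y P / eval2 x y Q" "b = eval2 u v P / eval2 u v Q"
    "a' = eval2 x y P' / eval2 x y Q'" "b' = eval2 u v P' / eval2 u v Q'"
    and nz: "eval2 u v Q \<noteq> 0" "eval2 u v Q' \<noteq> 0"
    by (auto simp: specialisation_def)
  from nz have nz': "eval2 x y Q \<noteq> 0" "eval2 x y Q' \<noteq> 0"
    by (auto simp: eval2_eq_0_iff)
  have "a - a' = eval2 x y (P * Q' - P' * Q) / eval2 x y (Q * Q')"
       "b - b' = eval2 u v (P * Q' - P' * Q) / eval2 u v (Q * Q')"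
    using nz nz' by (simp_all add: PQ eval2_diff eval2_mult diff_frac_eq)
  thus "(a - a', b - b') \<in> specialisation u v"
    using specialisationI[of u v "Q * Q'" "P * Q' - P' * Q"] nz by (simp add: eval2_mult)
  have "a * a' = eval2 x y (P * P') / eval2 x y (Q * Q')"
       "b * b' = eval2 u v (P * P') / eval2 u v (Q * Q')"
    by (simp_all add: PQ eval2_mult)
  thus "(a * a', b * b') \<in> specialisation u v"
    using specialisationI[of u v "Q * Q'" "P * P'"] nz by (simp add: eval2_mult)
next
  fix a b assume "(a, b) \<in> specialisation u v" "b \<noteq> 0"
  then obtain P Q where "a = eval2 x y P / eval2 x y Q" "b = eval2 u v P / eval2 u v Q"
    "eval2 u v P \<noteq> 0"
    by (auto simp: specialisation_def)
  thus "(inverse a, inverse b) \<in> specialisation u v"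
    using specialisationI[of u v P Q] by simp
next
  fix b assume "(0, b) \<in> specialisation u v"
  thus "b = 0"
    by (auto simp: specialisation_def eval2_eq_0_iff)
qed

lemma specialisation_incl:
  "(c z, c z) \<in> specialisation u v" "(x, u) \<in> specialisation u v" "(y, v) \<in> specialisation u v"
  using eval2_in_specialisation[of "[:[:z:]:]" u v] eval2_in_specialisation[of "[:[:0, 1:]:]" u v]
    eval2_in_specialisation[of "[:0, 1:]" u v] by simp_all

section \<open>Transcendence of the variables and algebraicity over the value of S\<close>

definition transcendental_elt :: "'k \<Rightarrow> bool" where
  "transcendental_elt z \<longleftrightarrow> (\<forall>q. poly (map_poly c q) z = 0 \<longrightarrow> q = 0)"

lemma transcendental_x: "transcendental_elt x"
  unfolding transcendental_elt_def
proof (intro allI impI)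
  fix q assume "poly (map_poly c q) x = 0"
  hence "eval2 x y [:q:] = 0"
    by (simp add: eval2_def map_poly_pCons)
  thus "q = 0"
    by (simp add: eval2_eq_0_iff)
qed

lemma transcendental_y: "transcendental_elt y"
  unfolding transcendental_elt_def
proof (intro allI impI)
  fix q assume *: "poly (map_poly c q) y = 0"
  \<comment> \<open>To test \<open>y\<close> alone, \<open>q\<close> is lifted to a polynomial in
    two variables whose coefficients are constant in \<open>x\<close>.\<close>
  have "map_poly (\<lambda>q. poly (map_poly c q) x) (map_poly (\<lambda>a. [:a:]) q) = map_poly c q"
    by (rule poly_eqI) (simp add: coeff_map_poly map_poly_pCons c_simps)
  hence "eval2 x y (map_poly (\<lambda>a. [:a:]) q) = 0"
    using * by (simp add: eval2_def)
  hence "map_poly (\<lambda>a. [:a:]) q = 0"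
    by (simp add: eval2_eq_0_iff)
  hence "[:coeff q i:] = 0" for i
    using coeff_map_poly[of "\<lambda>a. [:a:]" q i] by simp
  thus "q = 0"
    by (auto intro: poly_eqI)
qed

lemma transcendental_nonzero: "transcendental_elt z \<Longrightarrow> z \<noteq> 0"
  unfolding transcendental_elt_def by (auto simp: map_poly_pCons c_simps dest: spec[of _ "[:0, 1:]"])

lemma x_nonzero: "x \<noteq> 0" and y_nonzero: "y \<noteq> 0"
  using transcendental_nonzero transcendental_x transcendental_y by blast+

lemma poly_map_poly_sum:
  "poly (map_poly c (sum f I)) z = (\<Sum>s\<in>I. poly (map_poly c (f s)) z)"
  by (induction I rule: infinite_finite_induct) (simp_all add: poly_map_poly_add c_simps)

text \<open>Injectivity of \<open>e\<close> keeps the monomials apart, so after clearing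
  denominators the coefficient of any one of them is some \<open>a s\<close>, contradicting
  transcendence of \<open>z\<close>.\<close>

lemma laurent_nonzero:
  fixes e :: "'i \<Rightarrow> int"
  assumes z: "transcendental_elt z" and I: "finite I" "I \<noteq> {}" "inj_on e I" "\<And>s. s \<in> I \<Longrightarrow> a s \<noteq> 0"
  shows "(\<Sum>s\<in>I. c (a s) * z powi e s) \<noteq> 0"
proof
  assume zero: "(\<Sum>s\<in>I. c (a s) * z powi e s) = 0"
  obtain N :: nat where N: "\<And>s. s \<in> I \<Longrightarrow> e s + int N \<ge> 0"
    using laurent_shift[OF \<open>finite I\<close>] by blast
  define q where "q = (\<Sum>s\<in>I. monom (a s) (nat (e s + int N)))"
  have "poly (map_poly c q) z = (\<Sum>s\<in>I. c (a s) * (z powi e s * z ^ N))"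
    using N transcendental_nonzero[OF z]
    by (simp add: q_def poly_map_poly_sum map_poly_monom c_simps poly_monom power_int_shift)
  also have "\<dots> = (\<Sum>s\<in>I. c (a s) * z powi e s) * z ^ N"
    by (simp add: sum_distrib_right mult.assoc)
  finally have "q = 0"
    using z zero by (simp add: transcendental_elt_def)
  obtain s where s: "s \<in> I"
    using I(2) by blast
  have "nat (e s' + int N) = nat (e s + int N) \<longleftrightarrow> s' = s" if "s' \<in> I" for s'
    using N[OF that] N[OF s] inj_onD[OF I(3) _ that s] by auto
  hence "coeff q (nat (e s + int N)) = (\<Sum>s'\<in>I. if s' = s then a s' else 0)"
    by (simp add: q_def coeff_sum cong: sum.cong)
  also have "\<dots> = a s"
    using s I(1) by simp
  finally show False
    using \<open>q = 0\<close> I(4)[OF s] by simp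
qed

lemma step_poly_sum:
  "step_poly c \<S> w (u, v) = (\<Sum>s\<in>\<S>. c (w s) * u powi fst s * v powi snd s)"
  by (simp add: step_poly_def case_prod_unfold)

text \<open>\<open>y\<close> is a root of S(x, Y) - S(x, y). This is nonzero because a step with
  \<open>j \<noteq> 0\<close> exists, and the coefficient of the corresponding power of Y is a
  Laurent polynomial in \<open>x\<close> with distinct exponents and nonzero weights.\<close>

lemma y_algebraic:
  assumes F: "partial_iso (Id_on F)" "range c \<subseteq> F" "x \<in> F" "step_poly c \<S> w (x, y) \<in> F"
  shows "\<exists>m. m \<noteq> 0 \<and> (\<forall>i. coeff m i \<in> F) \<and> poly m y = 0"
proof -
  interpret F: partial_iso "Id_on F" by fact
  obtain i j where ij: "(i, j) \<in> \<S>" "j \<noteq> 0"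
    using not_univariate by (auto simp: not_univariate_def)
  show ?thesis
  proof (rule laurent_root_algebraic[OF F(1) finite_steps y_nonzero _ F(4)])
    show "c (w s) * x powi fst s \<in> F" for s
      using F.mult[of "c (w s)" "c (w s)", OF _ F.power_int[of x x "fst s"]] F(2,3) x_nonzero
      by (auto simp: Id_on_iff)
    show "(\<Sum>s\<in>\<S>. c (w s) * x powi fst s * y powi snd s) = step_poly c \<S> w (x, y)"
      by (simp add: step_poly_sum)
    show "(\<Sum>s | s \<in> \<S> \<and> snd s = j. c (w s) * x powi fst s) \<noteq> 0"
      using ij finite_steps weights
      by (intro laurent_nonzero transcendental_x) (force simp: inj_on_def prod_eq_iff)+
  qed fact
qed

text \<open>Mirror image of \<open>y_algebraic\<close>, with S read as a Laurent polynomial in its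
  first variable.\<close>

lemma x_algebraic:
  assumes F: "partial_iso (Id_on F)" "range c \<subseteq> F" "y \<in> F" "step_poly c \<S> w (x, y) \<in> F"
  shows "\<exists>m. m \<noteq> 0 \<and> (\<forall>i. coeff m i \<in> F) \<and> poly m x = 0"
proof -
  interpret F: partial_iso "Id_on F" by fact
  obtain i j where ij: "(i, j) \<in> \<S>" "i \<noteq> 0"
    using not_univariate by (auto simp: not_univariate_def)
  show ?thesis
  proof (rule laurent_root_algebraic[OF F(1) finite_steps x_nonzero _ F(4)])
    show "c (w s) * y powi snd s \<in> F" for s
      using F.mult[of "c (w s)" "c (w s)", OF _ F.power_int[of y y "snd s"]] F(2,3) y_nonzero
      by (auto simp: Id_on_iff)
    show "(\<Sum>s\<in>\<S>. c (w s) * y powi snd s * x powi fst s) = step_poly c \<S> w (x, y)"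
      by (simp add: step_poly_sum mult_ac)
    show "(\<Sum>s | s \<in> \<S> \<and> fst s = i. c (w s) * y powi snd s) \<noteq> 0"
      using ij finite_steps weights
      by (intro laurent_nonzero transcendental_y) (force simp: inj_on_def prod_eq_iff)+
  qed fact
qed

section \<open>Automorphisms carrying the starting pair to a neighbour\<close>

lemma automorphism_specialising:
  fixes a b u v :: 'k
  defines "F \<equiv> {z. (z, z) \<in> specialisation u v}"
  assumes ab: "(a, b) \<in> specialisation u v" and xy: "{x, y} \<subseteq> insert a F"
    and alg: "\<exists>m. m \<noteq> 0 \<and> (\<forall>i. coeff m i \<in> F) \<and> poly m a = 0"
  obtains \<sigma> where "field_automorphism \<sigma>" "\<And>z. z \<in> F \<Longrightarrow> \<sigma> z = z" "\<sigma> a = b"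
proof -
  interpret partial_hom "specialisation u v"
    by (rule partial_hom_specialisation)
  obtain m where m: "m \<noteq> 0" "\<And>i. coeff m i \<in> F" "poly m a = 0"
    using alg by blast
  show thesis
  proof (rule automorphism_extending_conjugation[of F a m b])
    show "partial_iso (Id_on F)"
      unfolding F_def by (rule partial_iso_fixed)
    show "\<exists>z. poly p z = 0" if "Polynomial.degree p > 0" for p :: "'k poly"
      using algebraic_closure_root[OF closure that] .
    \<comment> \<open>Constants are fixed by every specialisation, so adjoining \<open>a\<close> to
      \<open>F\<close> recovers all rational functions in \<open>x, y\<close>, over which the
      ambient field is algebraic.\<close>
    have "field_gen (range c \<union> {x, y}) \<subseteq> field_gen (insert a F)"
      using xy specialisation_incl(1)
      by (intro field_gen_subset partial_iso_field_gen) (auto intro!: field_gen_incl simp: F_def)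
    thus "\<exists>p. p \<noteq> 0 \<and> (\<forall>i. coeff p i \<in> field_gen (insert a F)) \<and> poly p z = 0" for z
      using algebraic_closure_algebraic[OF closure, of z] by blast
    \<comment> \<open>Specialisation keeps the coefficients of \<open>p\<close> and sends
      \<open>a\<close> to \<open>b\<close>, so it sends \<open>poly p a = 0\<close> to
      \<open>poly p b\<close>, which is zero by \<open>zero_left\<close>.\<close>
    show "poly p b = 0" if "\<And>i. coeff p i \<in> F" "poly p a = 0" for p
      using poly_fixed[of p, OF _ ab] that zero_left by (auto simp: F_def)
  qed (use m that in auto)
qed

text \<open>The equality S(x, v) = S(x, y) says that S(x, y) is fixed by the specialisation
  \<open>y \<mapsto> v\<close>. With the constants and \<open>x\<close> it lies in the fixed field,
  over which \<open>y\<close> is therefore algebraic.\<close>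

lemma automorphism_x:
  assumes "sim_x c \<S> w (x, y) (x, v)"
  obtains \<sigma> where "field_automorphism \<sigma>" "\<And>z. \<sigma> (c z) = c z"
    "\<sigma> (step_poly c \<S> w (x, y)) = step_poly c \<S> w (x, y)" "\<sigma> x = x" "\<sigma> y = v"
proof -
  interpret partial_hom "specialisation x v"
    by (rule partial_hom_specialisation)
  have "step_defined \<S> (x, v)" "step_poly c \<S> w (x, v) = step_poly c \<S> w (x, y)"
    using assms by (auto simp: sim_x_def same_step_value_def)
  hence t: "(step_poly c \<S> w (x, y), step_poly c \<S> w (x, y)) \<in> specialisation x v"
    using step_poly_rel[of c x x y v \<S> w] specialisation_incl by simp
  have alg: "\<exists>m. m \<noteq> 0 \<and> (\<forall>i. coeff m i \<in> {z. (z, z) \<in> specialisation x v}) \<and> poly m y = 0"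
    using t specialisation_incl by (intro y_algebraic partial_iso_fixed) auto
  show thesis
    using automorphism_specialising[OF specialisation_incl(3) _ alg] that t specialisation_incl
    by (smt (verit) insert_iff mem_Collect_eq singletonD subsetI)
qed

lemma automorphism_y:
  assumes "sim_y c \<S> w (x, y) (u, y)"
  obtains \<sigma> where "field_automorphism \<sigma>" "\<And>z. \<sigma> (c z) = c z"
    "\<sigma> (step_poly c \<S> w (x, y)) = step_poly c \<S> w (x, y)" "\<sigma> y = y" "\<sigma> x = u"
proof -
  interpret partial_hom "specialisation u y"
    by (rule partial_hom_specialisation)
  have "step_defined \<S> (u, y)" "step_poly c \<S> w (u, y) = step_poly c \<S> w (x, y)"
    using assms by (auto simp: sim_y_def same_step_value_def)
  hence t: "(step_poly c \<S> w (x, y), step_poly c \<S> w (x, y)) \<in> specialisation u y"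
    using step_poly_rel[of c x u y y \<S> w] specialisation_incl by simp
  have alg: "\<exists>m. m \<noteq> 0 \<and> (\<forall>i. coeff m i \<in> {z. (z, z) \<in> specialisation u y}) \<and> poly m x = 0"
    using t specialisation_incl by (intro x_algebraic partial_iso_fixed) auto
  show thesis
    using automorphism_specialising[OF specialisation_incl(2) _ alg] that t specialisation_incl
    by (smt (verit) insert_iff mem_Collect_eq singletonD subsetI)
qed

end

subsection \<open>Automorphism groups\<close>

text \<open>Bridge from maps to graphs. Injectivity excludes \<open>\<sigma> 1 = 0\<close>, so
  \<open>\<sigma> 1 * \<sigma> 1 = \<sigma> 1\<close> forces \<open>\<sigma> 1 = 1\<close>, and
  inverses are preserved.\<close>

lemma partial_iso_graph:
  fixes L :: "'k::field set"
  assumes L: "partial_iso (Id_on L)" and inj: "inj_on \<sigma> L"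
    and add: "\<And>a b. \<lbrakk>a \<in> L; b \<in> L\<rbrakk> \<Longrightarrow> \<sigma> (a + b) = \<sigma> a + \<sigma> b"
    and mult: "\<And>a b. \<lbrakk>a \<in> L; b \<in> L\<rbrakk> \<Longrightarrow> \<sigma> (a * b) = \<sigma> a * \<sigma> b"
  shows "partial_iso {(a, \<sigma> a) | a. a \<in> L}"
proof -
  interpret L: partial_iso "Id_on L" by fact
  have mem: "0 \<in> L" "1 \<in> L" "\<And>a b. \<lbrakk>a \<in> L; b \<in> L\<rbrakk> \<Longrightarrow> a - b \<in> L"
    "\<And>a b. \<lbrakk>a \<in> L; b \<in> L\<rbrakk> \<Longrightarrow> a * b \<in> L" "\<And>a. a \<in> L \<Longrightarrow> inverse a \<in> L"
    using L.zero L.one L.diff L.mult L.inv by (auto simp: Id_on_iff)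
  have \<sigma>0: "\<sigma> 0 = 0"
    using add[OF mem(1) mem(1)] by (metis add_0 add_right_cancel)
  have zero: "\<sigma> a = 0 \<longleftrightarrow> a = 0" if "a \<in> L" for a
    using inj_on_eq_iff[OF inj that mem(1)] \<sigma>0 by simp
  have \<sigma>1: "\<sigma> 1 = 1"
    using mult[OF mem(2) mem(2)] zero[OF mem(2)] by simp
  have diff: "\<sigma> (a - b) = \<sigma> a - \<sigma> b" if "a \<in> L" "b \<in> L" for a b
    using add[OF mem(3)[OF that] that(2)] by (simp add: algebra_simps)
  have inv: "\<sigma> (inverse a) = inverse (\<sigma> a)" if "a \<in> L" for a
  proof (cases "a = 0")
    case False
    hence "\<sigma> a * \<sigma> (inverse a) = 1"
      using mult[OF that mem(5)[OF that]] \<sigma>1 by simp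
    thus ?thesis
      by (metis inverse_unique)
  qed (simp add: \<sigma>0)
  show ?thesis
    by (rule partial_isoI) (auto simp: mem \<sigma>1 diff mult inv zero intro!: exI[of _ 1])
qed

context
  fixes L :: "'k::field set"
  assumes L: "partial_iso (Id_on L)"
begin

interpretation L: partial_iso "Id_on L"
  by (rule L)

lemma subfield_add: "\<lbrakk>a \<in> L; b \<in> L\<rbrakk> \<Longrightarrow> a + b \<in> L"
  using L.add[of a a b b] by (simp add: Id_on_iff)

lemma subfield_mult: "\<lbrakk>a \<in> L; b \<in> L\<rbrakk> \<Longrightarrow> a * b \<in> L"
  using L.mult[of a a b b] by (simp add: Id_on_iff)

text \<open>The unit condition of \<open>ring_hom\<close> is recovered from the graph of
  \<open>\<sigma>\<close>, which is a partial isomorphism.\<close>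

lemma field_Aut_iff:
  "\<sigma> \<in> field_Aut L F \<longleftrightarrow> \<sigma> \<in> Bij L \<and> (\<forall>a\<in>L. \<forall>b\<in>L. \<sigma> (a + b) = \<sigma> a + \<sigma> b) \<and>
     (\<forall>a\<in>L. \<forall>b\<in>L. \<sigma> (a * b) = \<sigma> a * \<sigma> b) \<and> (\<forall>a\<in>F. \<sigma> a = a)" (is "?l \<longleftrightarrow> ?r")
proof
  assume ?l
  thus ?r
    by (auto simp: field_Aut_def ring_hom_def subfield_ring_def)
next
  assume r: ?r
  hence "partial_iso {(a, \<sigma> a) | a. a \<in> L}"
    by (intro partial_iso_graph L) (auto simp: Bij_def bij_betw_def)
  then interpret \<sigma>: partial_iso "{(a, \<sigma> a) | a. a \<in> L}" .
  have "\<sigma> 1 = 1"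
    using \<sigma>.one by simp
  with r show ?l
    by (auto simp: field_Aut_def ring_hom_def subfield_ring_def dest: Bij_imp_funcset)
qed

lemma field_Aut_graph: "\<sigma> \<in> field_Aut L F \<Longrightarrow> partial_iso {(a, \<sigma> a) | a. a \<in> L}"
  by (intro partial_iso_graph L) (auto simp: field_Aut_iff Bij_def bij_betw_def)

text \<open>The inclusion of \<open>F\<close> in \<open>L\<close> matters because maps are
  extensional: the identity of \<open>BijGroup L\<close> is \<open>undefined\<close> outside
  \<open>L\<close>.\<close>

lemma subgroup_field_Aut:
  assumes "F \<subseteq> L"
  shows "subgroup (field_Aut L F) (BijGroup L)"
proof
  show "field_Aut L F \<subseteq> carrier (BijGroup L)"
    by (auto simp: field_Aut_def BijGroup_def)
  show "\<one>\<^bsub>BijGroup L\<^esub> \<in> field_Aut L F"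
    using assms by (auto simp: field_Aut_iff BijGroup_def id_Bij subfield_add subfield_mult)
next
  fix f g assume *: "f \<in> field_Aut L F" "g \<in> field_Aut L F"
  hence "f \<in> Bij L" "g \<in> Bij L" "\<And>a. a \<in> L \<Longrightarrow> g a \<in> L"
    using Bij_imp_funcset by (auto simp: field_Aut_iff)
  thus "f \<otimes>\<^bsub>BijGroup L\<^esub> g \<in> field_Aut L F"
    using * assms
    by (auto simp: field_Aut_iff BijGroup_def compose_Bij compose_eq subfield_add subfield_mult subset_iff)
next
  fix f assume f: "f \<in> field_Aut L F"
  hence bij: "f \<in> Bij L"
    by (simp add: field_Aut_iff)
  have "inv_into L f (a + b) = inv_into L f a + inv_into L f b" if "a \<in> L" "b \<in> L" for a b
    using f that by (intro Bij_inv_into_lemma[OF _ bij]) (auto simp: field_Aut_iff subfield_add)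
  moreover have "inv_into L f (a * b) = inv_into L f a * inv_into L f b" if "a \<in> L" "b \<in> L" for a b
    using f that by (intro Bij_inv_into_lemma[OF _ bij]) (auto simp: field_Aut_iff subfield_mult)
  moreover have "inv_into L f a = a" if "a \<in> F" for a
    using f that assms bij by (auto simp: field_Aut_iff Bij_def bij_betw_def intro: inv_into_f_eq)
  ultimately have "restrict (inv_into L f) L \<in> field_Aut L F"
    using assms by (auto simp: field_Aut_iff restrict_inv_into_Bij[OF bij] subfield_add subfield_mult)
  thus "inv\<^bsub>BijGroup L\<^esub> f \<in> field_Aut L F"
    using inv_BijGroup[OF bij] by simp
qed

end

lemma field_automorphism_graph:
  "field_automorphism \<sigma> \<Longrightarrow> partial_iso {(a, \<sigma> a) | a. a \<in> UNIV}"
  by (intro partial_iso_graph partial_isoI)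
    (auto simp: field_automorphism_def bij_def Id_on_iff inj_on_def)

lemma field_automorphism_inv:
  assumes "field_automorphism \<sigma>"
  shows "field_automorphism (inv_into UNIV \<sigma>)"
proof -
  have bij: "bij \<sigma>"
    using assms by (simp add: field_automorphism_def)
  hence eq: "inv_into UNIV \<sigma> a = b \<longleftrightarrow> a = \<sigma> b" and inv: "\<sigma> (inv_into UNIV \<sigma> a) = a" for a b
    by (metis bij_inv_eq_iff, metis bij_inv_eq_iff)
  show ?thesis
    using assms bij_imp_bij_inv[OF bij] by (simp add: field_automorphism_def eq inv)
qed

subsection \<open>The orbit\<close>

context walk
begin

abbreviation "orb \<equiv> walk_orbit c \<S> w x y"
abbreviation "stp \<equiv> step_poly c \<S> w (x, y)"
abbreviation "k \<equiv> base_field c \<S> w x y"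
abbreviation "L \<equiv> orbit_field c \<S> w x y"

lemma orbit_start: "(x, y) \<in> orb"
  by (simp add: walk_orbit_def)

lemma orbit_step: "\<lbrakk>p \<in> orb; sim_x c \<S> w p q \<or> sim_y c \<S> w p q\<rbrakk> \<Longrightarrow> q \<in> orb"
  unfolding walk_orbit_def by (auto intro: equivclp_into_equivclp)

text \<open>Both relations are symmetric, so the backward steps of \<open>equivclp\<close> can be
  read as forward ones.\<close>

lemma orbit_induct [consumes 1, case_names start step]:
  assumes "p \<in> orb" "P (x, y)"
    and step: "\<And>p q. \<lbrakk>p \<in> orb; sim_x c \<S> w p q \<or> sim_y c \<S> w p q; P p\<rbrakk> \<Longrightarrow> P q"
  shows "P p"
proof -
  have "equivclp (\<lambda>p q. sim_x c \<S> w p q \<or> sim_y c \<S> w p q) (x, y) p"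
    using assms(1) by (simp add: walk_orbit_def)
  thus ?thesis
  proof (induction rule: equivclp_induct)
    case base
    show ?case
      by fact
  next
    case (step p q)
    have "sim_x c \<S> w p q \<or> sim_y c \<S> w p q"
      using step.hyps(2) by (auto simp: sim_x_def sim_y_def same_step_value_def)
    thus ?case
      using assms(3)[of p q] step by (simp add: walk_orbit_def)
  qed
qed

lemma step_defined_start: "step_defined \<S> (x, y)"
  by (auto simp: step_defined_def x_nonzero y_nonzero)

text \<open>A partial isomorphism keeps nonzero coordinates nonzero, so definedness of S is carried
  along together with its value.\<close>

lemma same_step_value_transport:
  assumes "partial_iso R" "\<And>z. (c z, c z) \<in> R"
    and R: "(u\<^sub>1, u\<^sub>1') \<in> R" "(v\<^sub>1, v\<^sub>1') \<in> R" "(u\<^sub>2, u\<^sub>2') \<in> R" "(v\<^sub>2, v\<^sub>2') \<in> R"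
    and same: "same_step_value c \<S> w (u\<^sub>1, v\<^sub>1) (u\<^sub>2, v\<^sub>2)"
  shows "same_step_value c \<S> w (u\<^sub>1', v\<^sub>1') (u\<^sub>2', v\<^sub>2')"
proof -
  interpret partial_iso R by fact
  have def1: "step_defined \<S> (u\<^sub>1', v\<^sub>1')" and def2: "step_defined \<S> (u\<^sub>2', v\<^sub>2')"
    using same R[THEN eq_zero_iff] by (simp_all add: same_step_value_def step_defined_def)
  have "(step_poly c \<S> w (u\<^sub>1, v\<^sub>1), step_poly c \<S> w (u\<^sub>1', v\<^sub>1')) \<in> R"
       "(step_poly c \<S> w (u\<^sub>2, v\<^sub>2), step_poly c \<S> w (u\<^sub>2', v\<^sub>2')) \<in> R"
    using step_poly_rel assms(2) R def1 def2 by blast+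
  hence "step_poly c \<S> w (u\<^sub>1', v\<^sub>1') = step_poly c \<S> w (u\<^sub>2', v\<^sub>2')"
    using same single_valued by (metis same_step_value_def)
  with def1 def2 show ?thesis
    by (simp add: same_step_value_def)
qed

lemma sim_transport:
  assumes "partial_iso {(a, \<tau> a) | a. a \<in> A}" "range c \<subseteq> A" "\<And>z. \<tau> (c z) = c z"
    and "fst p \<in> A" "snd p \<in> A" "fst q \<in> A" "snd q \<in> A"
  shows "sim_x c \<S> w p q \<Longrightarrow> sim_x c \<S> w (pair_act \<tau> p) (pair_act \<tau> q)"
    and "sim_y c \<S> w p q \<Longrightarrow> sim_y c \<S> w (pair_act \<tau> p) (pair_act \<tau> q)"
proof -
  have c: "(c z, c z) \<in> {(a, \<tau> a) | a. a \<in> A}" for z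
    using assms(2) assms(3)[of z] by force
  have "same_step_value c \<S> w (pair_act \<tau> p) (pair_act \<tau> q)" if "same_step_value c \<S> w p q"
    using same_step_value_transport[OF assms(1) c, of "fst p" "\<tau> (fst p)" "snd p" "\<tau> (snd p)"
      "fst q" "\<tau> (fst q)" "snd q" "\<tau> (snd q)"] that assms(4-7)
    by (simp add: pair_act_def case_prod_unfold)
  thus "sim_x c \<S> w p q \<Longrightarrow> sim_x c \<S> w (pair_act \<tau> p) (pair_act \<tau> q)"
    "sim_y c \<S> w p q \<Longrightarrow> sim_y c \<S> w (pair_act \<tau> p) (pair_act \<tau> q)"
    by (auto simp: sim_x_def sim_y_def pair_act_def case_prod_unfold)
qed

text \<open>Since \<open>\<tau>\<close> fixes S(x, y) and one coordinate, it moves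
  \<open>(x, y)\<close> to a neighbour; equivariance handles the remaining steps of the chain. The
  set \<open>A\<close> allows both automorphisms of the ambient field and automorphisms of
  \<open>L\<close>.\<close>

lemma orbit_stable:
  assumes iso: "partial_iso {(a, \<tau> a) | a. a \<in> A}" and A: "range c \<subseteq> A" "stp \<in> A"
    and orb: "\<And>p. p \<in> orb \<Longrightarrow> fst p \<in> A \<and> snd p \<in> A"
    and fix_c: "\<And>z. \<tau> (c z) = c z" and fix_t: "\<tau> stp = stp" and fix_xy: "\<tau> x = x \<or> \<tau> y = y"
    and p: "p \<in> orb"
  shows "pair_act \<tau> p \<in> orb"
  using p
proof (induction rule: orbit_induct)
  case start
  interpret partial_iso "{(a, \<tau> a) | a. a \<in> A}" by fact
  have xy: "(x, \<tau> x) \<in> {(a, \<tau> a) | a. a \<in> A}" "(y, \<tau> y) \<in> {(a, \<tau> a) | a. a \<in> A}"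
    using orb[OF orbit_start] by auto
  have "step_defined \<S> (\<tau> x, \<tau> y)"
    using eq_zero_iff[OF xy(1)] eq_zero_iff[OF xy(2)] x_nonzero y_nonzero
    by (auto simp: step_defined_def)
  moreover from this have "step_poly c \<S> w (\<tau> x, \<tau> y) = stp"
    using step_poly_rel[of c x "\<tau> x" y "\<tau> y" \<S> w] xy A fix_c fix_t by force
  ultimately have "same_step_value c \<S> w (x, y) (\<tau> x, \<tau> y)"
    by (simp add: same_step_value_def step_defined_start)
  with fix_xy have "sim_x c \<S> w (x, y) (\<tau> x, \<tau> y) \<or> sim_y c \<S> w (x, y) (\<tau> x, \<tau> y)"
    by (auto simp: sim_x_def sim_y_def)
  thus ?case
    using orbit_step[OF orbit_start] by (simp add: pair_act_def)
next
  case (step p q)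
  have "q \<in> orb"
    using orbit_step step.hyps by blast
  thus ?case
    using sim_transport[OF iso A(1) fix_c, of p q] orb step orbit_step by blast
qed

section \<open>The orbit field and restriction to it\<close>

lemma subfield_L: "partial_iso (Id_on L)"
  unfolding orbit_field_def by (rule partial_iso_field_gen)

lemma base_in_k: "c z \<in> k" "stp \<in> k"
  by (auto simp: base_field_def intro: field_gen_incl)

lemma k_subset_L: "k \<subseteq> L"
  by (auto simp: orbit_field_def intro: field_gen_incl)

lemma orbit_in_L: "p \<in> orb \<Longrightarrow> fst p \<in> L \<and> snd p \<in> L"
  by (auto simp: orbit_field_def intro!: field_gen_incl)

lemma field_gen_subset_L: "A \<subseteq> {x, y} \<Longrightarrow> field_gen (k \<union> A) \<subseteq> L"
  using k_subset_L orbit_in_L[OF orbit_start] by (intro field_gen_subset subfield_L) auto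

text \<open>The preimage of \<open>L\<close> under \<open>\<sigma>\<close> is a subfield, and it
  contains the generators of \<open>L\<close> because \<open>\<sigma>\<close> fixes \<open>k\<close>
  and preserves the orbit.\<close>

lemma automorphism_image_L:
  assumes \<sigma>: "field_automorphism \<sigma>" and fix_c: "\<And>z. \<sigma> (c z) = c z" and fix_t: "\<sigma> stp = stp"
    and fix_xy: "\<sigma> x = x \<or> \<sigma> y = y"
  shows "\<sigma> ` L \<subseteq> L"
proof -
  interpret \<sigma>: partial_iso "{(a, \<sigma> a) | a. a \<in> UNIV}"
    using \<sigma> by (rule field_automorphism_graph)
  interpret L: partial_iso "Id_on L"
    by (rule subfield_L)
  have "k \<subseteq> {a. (a, a) \<in> {(a, \<sigma> a) | a. a \<in> UNIV}}"
    unfolding base_field_def using fix_c fix_t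
    by (intro field_gen_subset \<sigma>.partial_iso_fixed) force
  hence fix_k: "\<sigma> a = a" if "a \<in> k" for a
    using that by auto
  have "partial_iso (Id_on {a. \<sigma> a \<in> L})"
  proof (rule partial_isoI)
    show "(1, 1) \<in> Id_on {a. \<sigma> a \<in> L}"
      using L.one \<sigma>.one by (auto simp: Id_on_iff)
    fix a b a' b' assume "(a, b) \<in> Id_on {a. \<sigma> a \<in> L}" "(a', b') \<in> Id_on {a. \<sigma> a \<in> L}"
    thus "(a - a', b - b') \<in> Id_on {a. \<sigma> a \<in> L}" "(a * a', b * b') \<in> Id_on {a. \<sigma> a \<in> L}"
      using L.diff[of "\<sigma> a" "\<sigma> a" "\<sigma> a'" "\<sigma> a'"] \<sigma>.diff[of a "\<sigma> a" a' "\<sigma> a'"]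
        L.mult[of "\<sigma> a" "\<sigma> a" "\<sigma> a'" "\<sigma> a'"] \<sigma>.mult[of a "\<sigma> a" a' "\<sigma> a'"]
      by (auto simp: Id_on_iff)
  next
    fix a b assume "(a, b) \<in> Id_on {a. \<sigma> a \<in> L}"
    thus "(inverse a, inverse b) \<in> Id_on {a. \<sigma> a \<in> L}"
      using L.inv[of "\<sigma> a" "\<sigma> a"] \<sigma>.inv[of a "\<sigma> a"] by (auto simp: Id_on_iff)
  qed auto
  moreover have "k \<union> fst ` orb \<union> snd ` orb \<subseteq> {a. \<sigma> a \<in> L}"
  proof -
    have "\<sigma> (fst p) \<in> L \<and> \<sigma> (snd p) \<in> L" if "p \<in> orb" for p
      using orbit_in_L[OF orbit_stable[OF \<sigma>.partial_iso_axioms _ _ _ fix_c fix_t fix_xy that]]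
      by (simp add: pair_act_def case_prod_unfold)
    thus ?thesis
      using fix_k k_subset_L by auto
  qed
  ultimately have "L \<subseteq> {a. \<sigma> a \<in> L}"
    unfolding orbit_field_def by (rule field_gen_subset)
  thus ?thesis
    by blast
qed

text \<open>Stability of \<open>L\<close> under the inverse of \<open>\<sigma>\<close>, which
  satisfies the same hypotheses, makes the restriction surjective onto \<open>L\<close>.\<close>

lemma automorphism_restrict:
  assumes \<sigma>: "field_automorphism \<sigma>" and fix_c: "\<And>z. \<sigma> (c z) = c z" and fix_t: "\<sigma> stp = stp"
    and A: "A \<subseteq> {x, y}" "A \<noteq> {}" "\<And>a. a \<in> A \<Longrightarrow> \<sigma> a = a"
  shows "restrict \<sigma> L \<in> field_Aut L (field_gen (k \<union> A))"
proof -
  interpret \<sigma>: partial_iso "{(a, \<sigma> a) | a. a \<in> UNIV}"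
    using \<sigma> by (rule field_automorphism_graph)
  have bij: "bij \<sigma>"
    using \<sigma> by (simp add: field_automorphism_def)
  have inv_fix: "inv_into UNIV \<sigma> a = a" if "\<sigma> a = a" for a
    using bij that by (metis bij_inv_eq_iff)
  have fix_xy: "\<sigma> x = x \<or> \<sigma> y = y"
    using A by blast
  have 1: "\<sigma> ` L \<subseteq> L"
    by (rule automorphism_image_L) fact+
  have 2: "inv_into UNIV \<sigma> ` L \<subseteq> L"
    using fix_xy fix_c fix_t by (intro automorphism_image_L field_automorphism_inv \<sigma>) (auto intro: inv_fix)
  have "\<sigma> ` L = L"
  proof
    show "L \<subseteq> \<sigma> ` L"
      using 2 bij by (metis image_f_inv_f bij_is_surj image_mono)
  qed fact
  hence "bij_betw (restrict \<sigma> L) L L"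
    using bij by (auto simp: bij_betw_def bij_def inj_on_def)
  hence Bij: "restrict \<sigma> L \<in> Bij L"
    by (simp add: Bij_def)
  have "k \<subseteq> {a. (a, a) \<in> {(a, \<sigma> a) | a. a \<in> UNIV}}"
    unfolding base_field_def using fix_c fix_t
    by (intro field_gen_subset \<sigma>.partial_iso_fixed) force
  hence "field_gen (k \<union> A) \<subseteq> {a. (a, a) \<in> {(a, \<sigma> a) | a. a \<in> UNIV}}"
    using A(3) by (intro field_gen_subset \<sigma>.partial_iso_fixed) force
  hence "restrict \<sigma> L a = a" if "a \<in> field_gen (k \<union> A)" for a
    using that field_gen_subset_L[OF A(1)] by auto
  moreover have "restrict \<sigma> L (a + b) = restrict \<sigma> L a + restrict \<sigma> L b"
    "restrict \<sigma> L (a * b) = restrict \<sigma> L a * restrict \<sigma> L b" if "a \<in> L" "b \<in> L" for a b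
    using that \<sigma> subfield_add[OF subfield_L that] subfield_mult[OF subfield_L that]
    by (simp_all add: field_automorphism_def)
  ultimately show ?thesis
    using Bij unfolding field_Aut_iff[OF subfield_L] by blast
qed

end

subsection \<open>Transitivity\<close>

lemma carrier_Aut_group [simp]: "carrier (Aut_group L F) = field_Aut L F"
  by (simp add: Aut_group_def)

lemma mult_Aut_group [simp]:
  "\<lbrakk>\<sigma> \<in> Bij L; \<tau> \<in> Bij L\<rbrakk> \<Longrightarrow> \<sigma> \<otimes>\<^bsub>Aut_group L F\<^esub> \<tau> = compose L \<sigma> \<tau>"
  by (simp add: Aut_group_def BijGroup_def)

lemma one_Aut_group [simp]: "\<one>\<^bsub>Aut_group L F\<^esub> = restrict id L"
  by (simp add: Aut_group_def BijGroup_def id_def)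

lemma field_Aut_in_Bij: "\<sigma> \<in> field_Aut L F \<Longrightarrow> \<sigma> \<in> Bij L"
  by (simp add: field_Aut_def)

text \<open>In a left coset \<open>h\<close> is applied first, so the representative agrees with
  \<open>\<tau>\<close> on all points of \<open>L\<close> that \<open>h\<close> fixes.\<close>

lemma left_coset_representative:
  assumes "left_coset_reps (Aut_group L F) (field_Aut L E) I" "\<tau> \<in> field_Aut L F"
  shows "\<exists>g\<in>I. \<exists>h\<in>field_Aut L E. g = compose L \<tau> h"
proof -
  have "\<tau> <#\<^bsub>Aut_group L F\<^esub> field_Aut L E \<in> lcosets\<^bsub>Aut_group L F\<^esub> (field_Aut L E)"
    using assms(2) by (auto simp: LCOSETS_def)
  then obtain g where "g \<in> I" "g \<in> \<tau> <#\<^bsub>Aut_group L F\<^esub> field_Aut L E"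
    using assms(1) unfolding left_coset_reps_def by blast
  thus ?thesis
    using assms(2) by (auto simp: l_coset_def field_Aut_in_Bij)
qed

context walk
begin

lemma walk_Gx_eq: "walk_Gx c \<S> w x y = Aut_group L (field_gen (k \<union> {x}))"
  and walk_Gy_eq: "walk_Gy c \<S> w x y = Aut_group L (field_gen (k \<union> {y}))"
  and walk_Gxy_eq: "walk_Gxy c \<S> w x y = Aut_group L (field_gen (k \<union> {x, y}))"
  by (simp_all add: walk_Gx_def walk_Gy_def walk_Gxy_def)

lemma x_in_L: "x \<in> L" and y_in_L: "y \<in> L"
  using orbit_in_L[OF orbit_start] by simp_all

lemma field_Aut_fixes: "\<sigma> \<in> field_Aut L F \<Longrightarrow> a \<in> F \<Longrightarrow> \<sigma> a = a"
  by (simp add: field_Aut_def)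

lemma representative_x:
  assumes reps: "left_coset_reps (walk_Gx c \<S> w x y) (carrier (walk_Gxy c \<S> w x y)) Ix"
    and sim: "sim_x c \<S> w (x, y) q"
  shows "\<exists>g\<in>Ix. pair_act g (x, y) = q"
proof -
  obtain v where q: "q = (x, v)"
    using sim by (cases q) (auto simp: sim_x_def)
  obtain \<sigma> where \<sigma>: "field_automorphism \<sigma>" "\<And>z. \<sigma> (c z) = c z" "\<sigma> stp = stp" "\<sigma> x = x" "\<sigma> y = v"
    using automorphism_x sim q by metis
  have "restrict \<sigma> L \<in> field_Aut L (field_gen (k \<union> {x}))"
    using \<sigma> by (intro automorphism_restrict) auto
  then obtain g h where g: "g \<in> Ix" "h \<in> field_Aut L (field_gen (k \<union> {x, y}))"
    "g = compose L (restrict \<sigma> L) h"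
    using left_coset_representative reps unfolding walk_Gx_eq walk_Gxy_eq carrier_Aut_group by blast
  have "h x = x" "h y = y"
    using g(2) by (auto intro!: field_Aut_fixes field_gen_incl)
  hence "pair_act g (x, y) = q"
    using \<sigma> x_in_L y_in_L by (simp add: g(3) q pair_act_def compose_def)
  with g(1) show ?thesis
    by blast
qed

lemma representative_y:
  assumes reps: "left_coset_reps (walk_Gy c \<S> w x y) (carrier (walk_Gxy c \<S> w x y)) Iy"
    and sim: "sim_y c \<S> w (x, y) q"
  shows "\<exists>g\<in>Iy. pair_act g (x, y) = q"
proof -
  obtain u where q: "q = (u, y)"
    using sim by (cases q) (auto simp: sim_y_def)
  obtain \<sigma> where \<sigma>: "field_automorphism \<sigma>" "\<And>z. \<sigma> (c z) = c z" "\<sigma> stp = stp" "\<sigma> y = y" "\<sigma> x = u"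
    using automorphism_y sim q by metis
  have "restrict \<sigma> L \<in> field_Aut L (field_gen (k \<union> {y}))"
    using \<sigma> by (intro automorphism_restrict) auto
  then obtain g h where g: "g \<in> Iy" "h \<in> field_Aut L (field_gen (k \<union> {x, y}))"
    "g = compose L (restrict \<sigma> L) h"
    using left_coset_representative reps unfolding walk_Gy_eq walk_Gxy_eq carrier_Aut_group by blast
  have "h x = x" "h y = y"
    using g(2) by (auto intro!: field_Aut_fixes field_gen_incl)
  hence "pair_act g (x, y) = q"
    using \<sigma> x_in_L y_in_L by (simp add: g(3) q pair_act_def compose_def)
  with g(1) show ?thesis
    by blast
qed

section \<open>The group of the walk and its action on pairs\<close>

definition gens :: "('k \<Rightarrow> 'k) set" where
  "gens = field_Aut L (field_gen (k \<union> {x})) \<union> field_Aut L (field_gen (k \<union> {y}))"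

lemma group_Aut: "group (Aut_group L k)"
  unfolding Aut_group_def
  by (intro subgroup.subgroup_is_group subgroup_field_Aut subfield_L k_subset_L group_BijGroup)

lemma gens_subset: "gens \<subseteq> field_Aut L k"
  by (auto simp: gens_def field_Aut_def intro: field_gen_incl)

text \<open>Inverses agree with those of \<open>BijGroup L\<close>, in which both parts of
  \<open>gens\<close> are subgroups.\<close>

lemma inv_gens:
  assumes "h \<in> gens"
  shows "inv\<^bsub>Aut_group L k\<^esub> h \<in> gens"
proof -
  have "inv\<^bsub>Aut_group L k\<^esub> h = inv\<^bsub>BijGroup L\<^esub> h"
    unfolding Aut_group_def
    using assms gens_subset
    by (intro group.m_inv_consistent group_BijGroup subgroup_field_Aut subfield_L k_subset_L) auto
  moreover have "inv\<^bsub>BijGroup L\<^esub> h \<in> gens"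
    using assms subgroup.m_inv_closed[OF subgroup_field_Aut[OF subfield_L field_gen_subset_L[of "{x}"]]]
      subgroup.m_inv_closed[OF subgroup_field_Aut[OF subfield_L field_gen_subset_L[of "{y}"]]]
    by (auto simp: gens_def)
  ultimately show ?thesis
    by simp
qed

lemma gens_orbit:
  assumes "h \<in> gens" "p \<in> orb"
  shows "pair_act h p \<in> orb"
proof (rule orbit_stable[where A = L])
  show "partial_iso {(a, h a) | a. a \<in> L}"
    using assms(1) field_Aut_graph[OF subfield_L] unfolding gens_def by blast
  have fixed: "h a = a" if "a \<in> k" for a
    using assms(1) gens_subset field_Aut_fixes that by blast
  show "h (c z) = c z" for z
    using fixed base_in_k by blast
  show "h stp = stp"
    using fixed base_in_k by blast
  show "h x = x \<or> h y = y"
    using assms(1) by (auto simp: gens_def intro: field_Aut_fixes field_gen_incl)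
  show "range c \<subseteq> L" "stp \<in> L"
    using base_in_k k_subset_L by auto
qed (use orbit_in_L assms(2) in auto)

lemma pair_act_compose: "p \<in> orb \<Longrightarrow> pair_act (compose L \<sigma> \<tau>) p = pair_act \<sigma> (pair_act \<tau> p)"
  using orbit_in_L[of p] by (simp add: pair_act_def case_prod_unfold compose_def)

lemma pair_act_id: "p \<in> orb \<Longrightarrow> pair_act (restrict id L) p = p"
  using orbit_in_L[of p] by (simp add: pair_act_def case_prod_unfold)

lemma generated_in_Aut: "\<sigma> \<in> generate (Aut_group L k) gens \<Longrightarrow> \<sigma> \<in> field_Aut L k"
  using group.generate_in_carrier[OF group_Aut, of gens \<sigma>] gens_subset by simp

lemma generated_orbit:
  assumes "\<sigma> \<in> generate (Aut_group L k) gens" "p \<in> orb"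
  shows "pair_act \<sigma> p \<in> orb"
  using assms
proof (induction arbitrary: p rule: generate.induct)
  case (eng h1 h2)
  have "h1 \<in> Bij L" "h2 \<in> Bij L"
    using generated_in_Aut eng.hyps field_Aut_in_Bij by blast+
  thus ?case
    using eng by (simp add: pair_act_compose)
qed (simp_all add: pair_act_id gens_orbit inv_gens)

text \<open>Induction along the orbit: if \<open>\<sigma>\<close> carries \<open>(x, y)\<close> to
  \<open>p\<close> and \<open>q\<close> is a neighbour of \<open>p\<close>, pulling back by the
  inverse of \<open>\<sigma>\<close> makes \<open>q\<close> a neighbour of \<open>(x, y)\<close>,
  where a coset representative is available.\<close>

theorem transitive_on_orbit:
  fixes Ix Iy :: "('k \<Rightarrow> 'k) set"
  defines "G \<equiv> walk_group c \<S> w x y"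
  assumes Ix: "left_coset_reps (walk_Gx c \<S> w x y) (carrier (walk_Gxy c \<S> w x y)) Ix"
    and Iy: "left_coset_reps (walk_Gy c \<S> w x y) (carrier (walk_Gxy c \<S> w x y)) Iy"
  shows "transitive_action (G\<lparr>carrier := generate G (Ix \<union> Iy)\<rparr>) orb (\<lambda>\<sigma>. restrict (pair_act \<sigma>) orb)"
    and "\<forall>(u, v)\<in>orb. \<exists>\<sigma>\<in>generate G (Ix \<union> Iy). pair_act \<sigma> (x, y) = (u, v)"
proof -
  define H where "H = generate G (Ix \<union> Iy)"
  define N where "N = G\<lparr>carrier := H\<rparr>"
  have G: "G = (Aut_group L k)\<lparr>carrier := generate (Aut_group L k) gens\<rparr>"
    by (simp add: G_def walk_group_def walk_Gx_eq walk_Gy_eq gens_def Let_def)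
  have "subgroup (generate (Aut_group L k) gens) (Aut_group L k)"
    using group.generate_is_subgroup[OF group_Aut] gens_subset by simp
  hence group_G: "group G"
    unfolding G by (intro subgroup.subgroup_is_group group_Aut)
  have "Ix \<union> Iy \<subseteq> gens"
    using Ix Iy by (auto simp: left_coset_reps_def walk_Gx_eq walk_Gy_eq gens_def)
  hence I: "Ix \<union> Iy \<subseteq> carrier G"
    by (auto simp: G intro: generate.incl)
  have sub_H: "subgroup H G"
    unfolding H_def by (rule group.generate_is_subgroup[OF group_G I])
  interpret N: group N
    unfolding N_def by (rule subgroup.subgroup_is_group[OF sub_H group_G])
  have carrier_N: "carrier N = H"
    by (simp add: N_def)
  have H: "\<sigma> \<in> generate (Aut_group L k) gens" if "\<sigma> \<in> H" for \<sigma>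
    using subgroup.subset[OF sub_H] that by (auto simp: G)
  have Aut: "\<sigma> \<in> field_Aut L k" and Bij: "\<sigma> \<in> Bij L" if "\<sigma> \<in> H" for \<sigma>
    using generated_in_Aut[OF H[OF that]] field_Aut_in_Bij by blast+
  have orbit: "pair_act \<sigma> p \<in> orb" if "\<sigma> \<in> H" "p \<in> orb" for \<sigma> p
    using generated_orbit H that by blast
  have mult: "pair_act (\<sigma> \<otimes>\<^bsub>N\<^esub> \<tau>) p = pair_act \<sigma> (pair_act \<tau> p)"
    if "\<sigma> \<in> H" "\<tau> \<in> H" "p \<in> orb" for \<sigma> \<tau> p
    using that Bij by (simp add: N_def G pair_act_compose)
  have one: "pair_act \<one>\<^bsub>N\<^esub> p = p" if "p \<in> orb" for p
    using that by (simp add: N_def G pair_act_id)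
  have inv_H: "inv\<^bsub>N\<^esub> \<sigma> \<in> H" if "\<sigma> \<in> H" for \<sigma>
    using N.inv_closed that by (simp add: carrier_N)
  have inv_act: "pair_act (inv\<^bsub>N\<^esub> \<sigma>) (pair_act \<sigma> p) = p" "pair_act \<sigma> (pair_act (inv\<^bsub>N\<^esub> \<sigma>) p) = p"
    if "\<sigma> \<in> H" "p \<in> orb" for \<sigma> p
    using mult[OF inv_H[OF that(1)] that] mult[OF that(1) inv_H[OF that(1)] that(2)] one[OF that(2)]
      N.l_inv[of \<sigma>] N.r_inv[of \<sigma>] that(1) by (simp_all add: carrier_N)
  have start: "\<exists>\<sigma>\<in>H. pair_act \<sigma> (x, y) = p" if "p \<in> orb" for p
    using that
  proof (induction rule: orbit_induct)
    case start
    show ?case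
      using one[OF orbit_start] N.one_closed by (auto simp: carrier_N)
  next
    case (step p q)
    then obtain \<sigma> where \<sigma>: "\<sigma> \<in> H" "pair_act \<sigma> (x, y) = p"
      by blast
    define \<tau> where "\<tau> = inv\<^bsub>N\<^esub> \<sigma>"
    have \<tau>: "\<tau> \<in> H"
      using inv_H \<sigma> by (simp add: \<tau>_def)
    have q: "q \<in> orb"
      using orbit_step step.hyps by blast
    have \<tau>p: "pair_act \<tau> p = (x, y)"
      using inv_act(1)[OF \<sigma>(1) orbit_start] \<sigma>(2) by (simp add: \<tau>_def)
    have "sim_x c \<S> w (pair_act \<tau> p) (pair_act \<tau> q) \<or> sim_y c \<S> w (pair_act \<tau> p) (pair_act \<tau> q)"
    proof -
      have "\<tau> (c z) = c z" for z
        using field_Aut_fixes[OF Aut[OF \<tau>]] base_in_k by blast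
      thus ?thesis
        using sim_transport[OF field_Aut_graph[OF subfield_L Aut[OF \<tau>]], of p q] step.hyps(2)
          orbit_in_L[OF step.hyps(1)] orbit_in_L[OF q] base_in_k k_subset_L by blast
    qed
    then obtain g where g: "g \<in> Ix \<union> Iy" "pair_act g (x, y) = pair_act \<tau> q"
      using representative_x[OF Ix] representative_y[OF Iy] unfolding \<tau>p by blast
    have "g \<in> H"
      using g(1) by (auto simp: H_def intro: generate.incl)
    \<comment> \<open>First \<open>g\<close> moves \<open>(x, y)\<close> to the pulled back
      neighbour, then \<open>\<sigma>\<close> pushes it forward to \<open>q\<close>.\<close>
    have "pair_act (\<sigma> \<otimes>\<^bsub>N\<^esub> g) (x, y) = q"
      using mult[OF \<sigma>(1) \<open>g \<in> H\<close> orbit_start] inv_act(2)[OF \<sigma>(1) q] g(2) by (simp add: \<tau>_def)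
    moreover have "\<sigma> \<otimes>\<^bsub>N\<^esub> g \<in> H"
      using N.m_closed \<sigma>(1) \<open>g \<in> H\<close> by (simp add: carrier_N)
    ultimately show ?case
      by blast
  qed
  have act_Bij: "restrict (pair_act \<sigma>) orb \<in> Bij orb" if "\<sigma> \<in> H" for \<sigma>
  proof -
    have "bij_betw (pair_act \<sigma>) orb orb"
      by (rule bij_betw_byWitness[where f' = "pair_act (inv\<^bsub>N\<^esub> \<sigma>)"])
        (use inv_act inv_H orbit that in auto)
    thus ?thesis
      by (simp add: Bij_def)
  qed
  have "group_hom N (BijGroup orb) (\<lambda>\<sigma>. restrict (pair_act \<sigma>) orb)"
  proof (intro group_hom.intro group_hom_axioms.intro N.group_axioms group_BijGroup homI)
    fix \<sigma> assume "\<sigma> \<in> carrier N"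
    thus "restrict (pair_act \<sigma>) orb \<in> carrier (BijGroup orb)"
      using act_Bij by (simp add: carrier_N BijGroup_def)
  next
    fix \<sigma> \<tau> assume "\<sigma> \<in> carrier N" "\<tau> \<in> carrier N"
    hence st: "\<sigma> \<in> H" "\<tau> \<in> H"
      by (simp_all add: carrier_N)
    show "restrict (pair_act (\<sigma> \<otimes>\<^bsub>N\<^esub> \<tau>)) orb =
        restrict (pair_act \<sigma>) orb \<otimes>\<^bsub>BijGroup orb\<^esub> restrict (pair_act \<tau>) orb"
      using act_Bij[OF st(1)] act_Bij[OF st(2)] mult[OF st] orbit[OF st(2)]
      by (auto simp: BijGroup_def compose_def restrict_def)
  qed
  hence "transitive_action N orb (\<lambda>\<sigma>. restrict (pair_act \<sigma>) orb)"
  proof (intro transitive_action.intro group_action.intro transitive_action_axioms.intro)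
    fix p q assume pq: "p \<in> orb" "q \<in> orb"
    obtain \<sigma> \<tau> where st: "\<sigma> \<in> H" "pair_act \<sigma> (x, y) = p" "\<tau> \<in> H" "pair_act \<tau> (x, y) = q"
      using start pq by meson
    \<comment> \<open>Two arbitrary pairs are connected by passing through
      \<open>(x, y)\<close>.\<close>
    have "pair_act (\<tau> \<otimes>\<^bsub>N\<^esub> inv\<^bsub>N\<^esub> \<sigma>) p = q"
      using mult[OF st(3) inv_H[OF st(1)] pq(1)] inv_act(1)[OF st(1) orbit_start] st by simp
    moreover have "\<tau> \<otimes>\<^bsub>N\<^esub> inv\<^bsub>N\<^esub> \<sigma> \<in> carrier N"
      using st inv_H by (intro N.m_closed) (simp_all add: carrier_N)
    ultimately show "\<exists>g\<in>carrier N. restrict (pair_act g) orb p = q"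
      using pq by auto
  qed
  thus "transitive_action (G\<lparr>carrier := generate G (Ix \<union> Iy)\<rparr>) orb (\<lambda>\<sigma>. restrict (pair_act \<sigma>) orb)"
    by (simp add: N_def H_def)
  show "\<forall>(u, v)\<in>orb. \<exists>\<sigma>\<in>generate G (Ix \<union> Iy). pair_act \<sigma> (x, y) = (u, v)"
    using start by (auto simp: H_def)
qed

end

theorem mainTheorem2:
  fixes c :: "complex \<Rightarrow> 'k::field"
    and \<S> :: "(int \<times> int) set"
    and w :: "int \<times> int \<Rightarrow> complex"
    and x y :: 'k
    and Ix Iy :: "('k \<Rightarrow> 'k) set"
  defines "G \<equiv> walk_group c \<S> w x y"
    and "\<O> \<equiv> walk_orbit c \<S> w x y"
  assumes "finite \<S>"
    and "\<forall>s\<in>\<S>. w s \<noteq> 0"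
    and "not_univariate \<S>"
    and "c \<in> ring_hom (ring_of_type_algebra :: complex ring) (ring_of_type_algebra :: 'k ring)"
    and "alg_indep2 c x y"
    and "algebraic_closure (ring_of_type_algebra :: 'k ring) (field_gen (range c \<union> {x, y}))"
    and "left_coset_reps (walk_Gx c \<S> w x y) (carrier (walk_Gxy c \<S> w x y)) Ix"
    and "left_coset_reps (walk_Gy c \<S> w x y) (carrier (walk_Gxy c \<S> w x y)) Iy"
  shows "transitive_action (G\<lparr>carrier := generate G (Ix \<union> Iy)\<rparr>) \<O> (\<lambda>\<sigma>. restrict (pair_act \<sigma>) \<O>) \<and>
         (\<forall>(u, v)\<in>\<O>. \<exists>\<sigma>\<in>generate G (Ix \<union> Iy). pair_act \<sigma> (x, y) = (u, v))"
proof -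
  interpret walk c \<S> w x y
    by (rule walk.intro) fact+
  show ?thesis
    unfolding G_def \<O>_def using transitive_on_orbit[OF assms(9,10)] by blast
qed

end
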